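(* Let $p,q,n,m\in\mathbb{Z}_{\geq 0}$. Then the space $T_{p,q,n,m}=\mathrm{Sym}_\infty^{p}\times\mathrm{Alt}_\infty^{q}\times(\mathbb{C}^\infty)^n\times\mathbb{C}^m$ is $G_\infty$-Noetherian.
   Context: $\mathbb{C}^\infty$ denotes the space of all sequences $(c_i)_{i\in\mathbb{N}}$ of complex numbers, viewed as column vectors; $\mathbb{C}^\infty_{\mathrm{fin}}=\bigcup_{k}\mathbb{C}^k$ is the subspace of finitely supported sequences. $\mathrm{Mat}_\infty$ is the space of all matrices $(m_{i,j})_{i,j\in\mathbb{N}}$ with complex entries (identified with linear maps $\mathbb{C}^\infty_{\mathrm{fin}}\to\mathbb{C}^\infty$); $\mathrm{Sym}_\infty$ and $\mathrm{Alt}_\infty$ are its subspaces of symmetric and skew-symmetric matrices. All these spaces, and finite products of them with $\mathbb{C}^m$, are regarded as infinite-dimensional affine spaces with the Zariski topology: the coordinate ring is the polynomial ring in all (countably many) coordinates, so each polynomial involves only finitely many coordinates, and closed sets are common zero sets of sets of polynomials. $G_\infty=\bigcup_{k}\mathrm{GL}_k(\mathbb{C})$, where $\mathrm{GL}_k$ is embedded via $g\mapsto\mathrm{diag}(g,\mathrm{Id})$. $G_\infty$ acts on $\mathbb{C}^\infty$ by left multiplication, on $\mathrm{Mat}_\infty$ (hence on $\mathrm{Sym}_\infty$, $\mathrm{Alt}_\infty$) by $g\cdot M=gMg^T$, componentwise on products, and trivially on $\mathbb{C}^m$. For a group $G$ acting on a topological space $X$, $X$ is $G$-Noetherian if every strictly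 descending chain of $G$-stable closed subsets of $X$ has finite length. *)

theory Defs
  imports Complex_Main
begin

text \<open>A point of the ambient space: (S, A, v, c) where S k, A k are the k-th
 matrices (nat x nat indexed), v k is the k-th vector, c k the k-th scalar.
 Only indices k < p, k < q, k < n, k < m are used in T p q n m (others are 0).\<close>
type_synonym pt =
  "(nat \<Rightarrow> nat \<Rightarrow> nat \<Rightarrow> complex) \<times> (nat \<Rightarrow> nat \<Rightarrow> nat \<Rightarrow> complex)
   \<times> (nat \<Rightarrow> nat \<Rightarrow> complex) \<times> (nat \<Rightarrow> complex)"

definition Tspace :: "nat \<Rightarrow> nat \<Rightarrow> nat \<Rightarrow> nat \<Rightarrow> pt set" where
  "Tspace p q n m = {(S, A, v, c).
     (\<forall>k<p. \<forall>i j. S k i j = S k j i) \<and> (\<forall>k\<ge>p. S k = (\<lambda>i j. 0)) \<and>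
     (\<forall>k<q. \<forall>i j. A k i j = - A k j i) \<and> (\<forall>k\<ge>q. A k = (\<lambda>i j. 0)) \<and>
     (\<forall>k\<ge>n. v k = (\<lambda>i. 0)) \<and> (\<forall>k\<ge>m. c k = 0)}"

datatype coord = SymC nat nat nat | AltC nat nat nat | VecC nat nat | ScalC nat

fun coord_val :: "coord \<Rightarrow> pt \<Rightarrow> complex" where
  "coord_val (SymC k i j) (S, A, v, c) = S k i j"
| "coord_val (AltC k i j) (S, A, v, c) = A k i j"
| "coord_val (VecC k i) (S, A, v, c) = v k i"
| "coord_val (ScalC k) (S, A, v, c) = c k"

inductive_set poly_funs :: "(pt \<Rightarrow> complex) set" where
  pconst: "(\<lambda>x. a) \<in> poly_funs"
| pcoord: "coord_val u \<in> poly_funs"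
| padd: "f \<in> poly_funs \<Longrightarrow> g \<in> poly_funs \<Longrightarrow> (\<lambda>x. f x + g x) \<in> poly_funs"
| pmult: "f \<in> poly_funs \<Longrightarrow> g \<in> poly_funs \<Longrightarrow> (\<lambda>x. f x * g x) \<in> poly_funs"

definition zariski_closed_in :: "pt set \<Rightarrow> pt set \<Rightarrow> bool" where
  "zariski_closed_in X Z \<longleftrightarrow> (\<exists>P \<subseteq> poly_funs. Z = {x \<in> X. \<forall>f\<in>P. f x = 0})"

text \<open>G_oo = union of GL_k embedded as diag(g, Id).\<close>
definition id_outside :: "nat \<Rightarrow> (nat \<Rightarrow> nat \<Rightarrow> complex) \<Rightarrow> bool" where
  "id_outside k g \<longleftrightarrow> (\<forall>i j. k \<le> i \<or> k \<le> j \<longrightarrow> g i j = (if i = j then 1 else 0))"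

definition Ginf :: "(nat \<Rightarrow> nat \<Rightarrow> complex) set" where
  "Ginf = {g. \<exists>k. id_outside k g \<and>
     (\<exists>h. id_outside k h \<and>
        (\<forall>i<k. \<forall>j<k. (\<Sum>l<k. g i l * h l j) = (if i = j then 1 else 0)))}"

text \<open>Left multiplication g v and g M g^T (finite sums, since each row of g
 has finitely many nonzero entries).\<close>
definition gvec :: "(nat \<Rightarrow> nat \<Rightarrow> complex) \<Rightarrow> (nat \<Rightarrow> complex) \<Rightarrow> nat \<Rightarrow> complex" where
  "gvec g w i = (\<Sum>a\<in>{a. g i a \<noteq> 0}. g i a * w a)"

definition gmat :: "(nat \<Rightarrow> nat \<Rightarrow> complex) \<Rightarrow> (nat \<Rightarrow> nat \<Rightarrow> complex) \<Rightarrow> nat \<Rightarrow> nat \<Rightarrow> complex" where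
  "gmat g M i j = (\<Sum>a\<in>{a. g i a \<noteq> 0}. \<Sum>b\<in>{b. g j b \<noteq> 0}. g i a * M a b * g j b)"

definition gact :: "(nat \<Rightarrow> nat \<Rightarrow> complex) \<Rightarrow> pt \<Rightarrow> pt" where
  "gact g x = (case x of (S, A, v, c) \<Rightarrow>
     ((\<lambda>k. gmat g (S k)), (\<lambda>k. gmat g (A k)), (\<lambda>k. gvec g (v k)), c))"

definition G_stable :: "pt set \<Rightarrow> bool" where
  "G_stable Z \<longleftrightarrow> (\<forall>g\<in>Ginf. \<forall>x\<in>Z. gact g x \<in> Z)"

definition G_noetherian :: "pt set \<Rightarrow> bool" where
  "G_noetherian X \<longleftrightarrow> \<not> (\<exists>Z :: nat \<Rightarrow> pt set.
      \<forall>i. zariski_closed_in X (Z i) \<and> G_stable (Z i) \<and> Z (Suc i) \<subset> Z i)"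

end

theory Submission
  imports Defs "HOL-Analysis.Analysis"
begin

text \<open>Only the stability under transvections (add \<open>t\<close> times row \<open>a\<close> to row \<open>i\<close>) is used. Matrices are
  added one at a time, after the vectors and the scalars, so the ambient space is fibred over a space \<open>B\<close>
  already known to be Noetherian, and by Noetherian induction it suffices to treat a proper closed stable
  subset \<open>X\<close> of the preimage of a closed \<open>B' \<subseteq> B\<close>. Take a polynomial \<open>f\<close> vanishing on \<open>X\<close> but not on this
  preimage, of minimal degree along the fibre. If it is constant along the fibres, \<open>B'\<close> can be shrunk.
  Otherwise some derivative \<open>h\<close> of \<open>f\<close> along the fibre does not vanish on the preimage; the largest stable
  subset of \<open>X\<close> where \<open>h = 0\<close> is handled by induction on the degree. The rest is swept out by the open
  part of \<open>X\<close> where \<open>h\<close> is nonzero: applying to \<open>f\<close> the derivations given by two transvections expresses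
  \<open>h\<close> times any entry of the new matrix with both indices large through the remaining coordinates, so that,
  for the transvections with large indices, this open part embeds into a space with one matrix less (and more
  vectors and scalars). A vector is eliminated in the same way by one transvection when no matrices are
  present; for scalars, pseudo-division replaces the elimination.\<close>

text \<open>\<open>Mc k\<close> is symmetric for even \<open>k\<close> and skew-symmetric for odd \<open>k\<close>. Vectors and scalars are
  indexed by lists so that rows and entries of matrices can be turned into further vectors and scalars
  (see \<open>slice\<close>).\<close>

datatype co = Mc nat nat nat | Vc "nat list" nat | Sc "nat list"

type_synonym wpt = "co \<Rightarrow> complex"

section \<open>Polynomial functions and directional derivatives\<close>

inductive_set polys :: "co set \<Rightarrow> (wpt \<Rightarrow> complex) set" for U where
  const: "(\<lambda>x. a) \<in> polys U"
| coord: "u \<in> U \<Longrightarrow> (\<lambda>x. x u) \<in> polys U"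
| add: "f \<in> polys U \<Longrightarrow> g \<in> polys U \<Longrightarrow> (\<lambda>x. f x + g x) \<in> polys U"
| mult: "f \<in> polys U \<Longrightarrow> g \<in> polys U \<Longrightarrow> (\<lambda>x. f x * g x) \<in> polys U"

lemma polys_mono:
  assumes "f \<in> polys U" "U \<subseteq> V" shows "f \<in> polys V"
  using assms(1) by induction (use assms(2) in \<open>auto intro: polys.intros\<close>)

lemma polys_UNIV: "f \<in> polys U \<Longrightarrow> f \<in> polys UNIV"
  by (rule polys_mono) auto

lemma polys_cong:
  assumes "f \<in> polys U" "\<And>u. u \<in> U \<Longrightarrow> x u = y u" shows "f x = f y"
  using assms(1) by induction (use assms(2) in auto)

lemma polys_subst:
  assumes "f \<in> polys U" "\<And>u. u \<in> U \<Longrightarrow> (\<lambda>x. \<xi> x u) \<in> polys V"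
  shows "(\<lambda>x. f (\<xi> x)) \<in> polys V"
  using assms(1) by induction (use assms(2) in \<open>auto intro: polys.intros\<close>)

lemma polys_cmult: "f \<in> polys U \<Longrightarrow> (\<lambda>x. a * f x) \<in> polys U"
  by (intro polys.intros)

lemma polys_minus: "f \<in> polys U \<Longrightarrow> (\<lambda>x. - f x) \<in> polys U"
  using polys_cmult[of f U "-1"] by simp

lemma polys_sum:
  "(\<And>i. i \<in> I \<Longrightarrow> f i \<in> polys U) \<Longrightarrow> (\<lambda>x. \<Sum>i\<in>I. f i x) \<in> polys U"
  by (induction I rule: infinite_finite_induct) (auto intro: polys.intros)

text \<open>Taken along a line, so that it depends on the function \<open>f\<close> alone and not on
  an expression that represents it.\<close>

definition D :: "(wpt \<Rightarrow> complex) \<Rightarrow> wpt \<Rightarrow> wpt \<Rightarrow> complex" where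
  "D f x z = deriv (\<lambda>t. f (\<lambda>u. x u + t * z u)) 0"

lemma D_chain:
  assumes "f \<in> polys U"
    and "\<And>u. u \<in> U \<Longrightarrow> ((\<lambda>t. \<gamma> t u) has_field_derivative z u) (at t0)"
  shows "((\<lambda>t. f (\<gamma> t)) has_field_derivative D f (\<gamma> t0) z) (at t0)"
proof -
  \<comment> \<open>The induction carries the chain rule for all curves at once, with a functional
    \<open>L\<close> that sees only the point and the velocity; the straight line through
    \<open>x\<close> then identifies \<open>L\<close> with \<open>D f\<close>.\<close>
  have "\<exists>L. \<forall>\<gamma> z t0. (\<forall>u\<in>U. ((\<lambda>t. \<gamma> t u) has_field_derivative z u) (at t0)) \<longrightarrow>
     ((\<lambda>t. f (\<gamma> t)) has_field_derivative L (\<gamma> t0) z) (at t0)"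
    using assms(1)
  proof induction
    case (const a)
    show ?case by (rule exI[of _ "\<lambda>x z. 0"]) simp
  next
    case (coord u)
    then show ?case by (intro exI[of _ "\<lambda>x z. z u"]) simp
  next
    case (add f g)
    then obtain L L' where
      "\<forall>\<gamma> z t0. (\<forall>u\<in>U. ((\<lambda>t. \<gamma> t u) has_field_derivative z u) (at t0)) \<longrightarrow>
        ((\<lambda>t. f (\<gamma> t)) has_field_derivative L (\<gamma> t0) z) (at t0)"
      "\<forall>\<gamma> z t0. (\<forall>u\<in>U. ((\<lambda>t. \<gamma> t u) has_field_derivative z u) (at t0)) \<longrightarrow>
        ((\<lambda>t. g (\<gamma> t)) has_field_derivative L' (\<gamma> t0) z) (at t0)" by blast
    then show ?case
      by (intro exI[of _ "\<lambda>x z. L x z + L' x z"]) (auto intro!: DERIV_add)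
  next
    case (mult f g)
    then obtain L L' where
      "\<forall>\<gamma> z t0. (\<forall>u\<in>U. ((\<lambda>t. \<gamma> t u) has_field_derivative z u) (at t0)) \<longrightarrow>
        ((\<lambda>t. f (\<gamma> t)) has_field_derivative L (\<gamma> t0) z) (at t0)"
      "\<forall>\<gamma> z t0. (\<forall>u\<in>U. ((\<lambda>t. \<gamma> t u) has_field_derivative z u) (at t0)) \<longrightarrow>
        ((\<lambda>t. g (\<gamma> t)) has_field_derivative L' (\<gamma> t0) z) (at t0)" by blast
    then show ?case
      by (intro exI[of _ "\<lambda>x z. L x z * g x + L' x z * f x"]) (auto intro!: DERIV_mult)
  qed
  then obtain L where L: "\<And>\<gamma> z t0. (\<forall>u\<in>U. ((\<lambda>t. \<gamma> t u) has_field_derivative z u) (at t0)) \<Longrightarrow>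
     ((\<lambda>t. f (\<gamma> t)) has_field_derivative L (\<gamma> t0) z) (at t0)" by blast
  have "D f x z = L x z" for x z
  proof -
    have "((\<lambda>t. f (\<lambda>u. x u + t * z u)) has_field_derivative L (\<lambda>u. x u + 0 * z u) z) (at 0)"
      by (rule L) (auto intro!: derivative_eq_intros)
    then show ?thesis unfolding D_def by (simp add: DERIV_imp_deriv)
  qed
  with L assms(2) show ?thesis by simp
qed

lemma D_line:
  assumes "f \<in> polys U"
  shows "((\<lambda>t. f (\<lambda>u. x u + t * z u)) has_field_derivative D f x z) (at 0)"
proof -
  have "((\<lambda>t. x u + t * z u) has_field_derivative z u) (at 0)" for u
    by (auto intro!: derivative_eq_intros)
  then show ?thesis using D_chain[OF assms, of "\<lambda>t u. x u + t * z u" z 0] by simp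
qed

lemma D_const [simp]: "D (\<lambda>x. a) x z = 0"
  unfolding D_def by simp

lemma D_coord [simp]: "D (\<lambda>x. x u) x z = z u"
  using D_line[OF polys.coord[of u UNIV], of x z]
  by (auto intro!: DERIV_imp_deriv derivative_eq_intros simp: D_def)

lemma D_add [simp]:
  assumes "f \<in> polys U" "g \<in> polys U"
  shows "D (\<lambda>x. f x + g x) x z = D f x z + D g x z"
  using DERIV_add[OF D_line[OF assms(1), of x z] D_line[OF assms(2), of x z]]
  by (simp add: D_def DERIV_imp_deriv)

lemma D_mult [simp]:
  assumes "f \<in> polys U" "g \<in> polys U"
  shows "D (\<lambda>x. f x * g x) x z = D f x z * g x + D g x z * f x"
  using DERIV_mult[OF D_line[OF assms(1), of x z] D_line[OF assms(2), of x z]]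
  by (simp add: D_def DERIV_imp_deriv)

lemma D_zero:
  assumes "f \<in> polys U" "\<And>u. u \<in> U \<Longrightarrow> z u = 0" shows "D f x z = 0"
  using assms(1) by induction (use assms(2) in auto)

lemma D_cong:
  assumes "f \<in> polys U" "\<And>u. u \<in> U \<Longrightarrow> z u = z' u" shows "D f x z = D f x z'"
  using assms(1) by induction (use assms(2) in auto)

lemma D_lin:
  assumes "f \<in> polys U"
  shows "D f x (\<lambda>u. c * z u + z' u) = c * D f x z + D f x z'"
  using assms by induction (auto simp: algebra_simps)

lemma D_sum:
  assumes "f \<in> polys U" "finite I"
  shows "D f x (\<lambda>u. \<Sum>i\<in>I. c i * E i u) = (\<Sum>i\<in>I. c i * D f x (E i))"
  using assms(2) by induction (auto simp: D_lin[OF assms(1)] D_zero[OF assms(1)])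

text \<open>By the product rule. The direction may vary with the point, as vector fields of
  one-parameter groups do; only its components in \<open>U\<close> have to be polynomial.\<close>

lemma polys_D:
  assumes "f \<in> polys U" "U \<subseteq> V" "\<And>u. u \<in> U \<Longrightarrow> (\<lambda>x. \<xi> x u) \<in> polys V"
  shows "(\<lambda>x. D f x (\<xi> x)) \<in> polys V"
  using assms(1)
proof induction
  case (mult f g)
  then have "f \<in> polys V" "g \<in> polys V" using assms(2) polys_mono by blast+
  then show ?case using mult by (auto intro!: polys.intros)
qed (use assms(2,3) in \<open>auto intro: polys.intros\<close>)

section \<open>Degree along a fibre: coordinates outside \<open>F\<close> count as constants\<close>

inductive deg_le :: "co set \<Rightarrow> nat \<Rightarrow> (wpt \<Rightarrow> complex) \<Rightarrow> bool" for F where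
  const: "deg_le F d (\<lambda>x. a)"
| base: "u \<notin> F \<Longrightarrow> deg_le F d (\<lambda>x. x u)"
| coord: "deg_le F (Suc d) (\<lambda>x. x u)"
| add: "deg_le F d f \<Longrightarrow> deg_le F d g \<Longrightarrow> deg_le F d (\<lambda>x. f x + g x)"
| mult: "deg_le F d f \<Longrightarrow> deg_le F e g \<Longrightarrow> deg_le F (d + e) (\<lambda>x. f x * g x)"

lemma deg_le_add: "deg_le F d f \<Longrightarrow> deg_le F (d + e) f"
proof (induction arbitrary: e rule: deg_le.induct)
  case (mult d f e' g)
  have "deg_le F ((d + e) + e') (\<lambda>x. f x * g x)" by (rule deg_le.mult[OF mult.IH(1) mult.hyps(2)])
  then show ?case by (simp add: ac_simps)
qed (auto intro: deg_le.intros)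

lemma deg_le_mono: "deg_le F d f \<Longrightarrow> d \<le> e \<Longrightarrow> deg_le F e f"
  using deg_le_add le_iff_add by metis

lemma deg_le_polys: "deg_le F d f \<Longrightarrow> f \<in> polys UNIV"
  by (induction rule: deg_le.induct) (auto intro: polys.intros)

lemma polys_deg_le: "f \<in> polys U \<Longrightarrow> \<exists>d. deg_le F d f"
proof (induction rule: polys.induct)
  case (add f g)
  then obtain d e where "deg_le F d f" "deg_le F e g" by blast
  then have "deg_le F (max d e) f" "deg_le F (max d e) g" by (auto intro: deg_le_mono)
  then show ?case by (blast intro: deg_le.intros)
qed (blast intro: deg_le.intros)+

text \<open>The clause for \<open>d = 0\<close> makes up for the truncated \<open>d - 1\<close>: in
  a product with a factor of degree 0, the summand that differentiates this factor meets the bound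
  because it vanishes.\<close>

lemma deg_le_D:
  assumes "deg_le F d f" "\<And>u. u \<notin> F \<Longrightarrow> E u = 0"
  shows "deg_le F (d - 1) (\<lambda>x. D f x E) \<and> (d = 0 \<longrightarrow> (\<forall>x. D f x E = 0))"
  using assms(1)
proof (induction rule: deg_le.induct)
  case (add d f g)
  then have "f \<in> polys UNIV" "g \<in> polys UNIV" by (auto intro: deg_le_polys)
  then show ?case using add by (auto intro: deg_le.intros)
next
  case (mult d f e g)
  then have p: "f \<in> polys UNIV" "g \<in> polys UNIV" by (auto intro: deg_le_polys)
  have 1: "deg_le F (d + e - 1) (\<lambda>x. D f x E * g x)"
  proof (cases d)
    case 0
    then show ?thesis using mult by (simp add: deg_le.const)
  next
    case (Suc n)
    then show ?thesis using deg_le.mult[of F n "\<lambda>x. D f x E" e g] mult by simp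
  qed
  have 2: "deg_le F (d + e - 1) (\<lambda>x. D g x E * f x)"
  proof (cases e)
    case 0
    then show ?thesis using mult by (simp add: deg_le.const)
  next
    case (Suc n)
    then show ?thesis using deg_le.mult[of F n "\<lambda>x. D g x E" d f] mult by (simp add: ac_simps)
  qed
  show ?case using deg_le.add[OF 1 2] mult p by auto
qed (auto intro: deg_le.intros assms(2))

section \<open>Transvections and Noetherian spaces\<close>

text \<open>The action of \<open>g = Id + t E_{i,a}\<close>. The terms for matrices are those of
  \<open>g M g^T\<close>; the one quadratic in \<open>t\<close> sits at the entry
  \<open>(i, i)\<close>.\<close>

fun tv :: "nat \<Rightarrow> nat \<Rightarrow> complex \<Rightarrow> wpt \<Rightarrow> wpt" where
  "tv i a t x (Mc k l m) = x (Mc k l m) + (if l = i then t * x (Mc k a m) else 0)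
     + (if m = i then t * x (Mc k l a) else 0) + (if l = i \<and> m = i then t * t * x (Mc k a a) else 0)"
| "tv i a t x (Vc k l) = x (Vc k l) + (if l = i then t * x (Vc k a) else 0)"
| "tv i a t x (Sc k) = x (Sc k)"

lemma tv_inverse: assumes "i \<noteq> a" shows "tv i a (- t) (tv i a t x) = x"
proof
  fix u show "tv i a (- t) (tv i a t x) u = x u"
  proof (cases u)
    case (Mc k l m)
    then show ?thesis using assms by (cases "l = i"; cases "m = i"; simp add: algebra_simps)
  qed (use assms in simp_all)
qed

lemma tv_zero: "tv i a 0 x = x"
proof
  fix u show "tv i a 0 x u = x u" by (cases u) auto
qed

lemma polys_tv: "(\<lambda>x. tv i a t x u) \<in> polys UNIV"
proof (cases u)
  case (Mc k l m)
  have c: "(\<lambda>x. if P then t' * x u' else 0) \<in> polys UNIV" for P t' u'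
    by (cases P) (simp_all add: polys.intros)
  show ?thesis unfolding Mc tv.simps by (intro polys.add c polys.coord UNIV_I)
next
  case (Vc k l)
  then show ?thesis by (cases "l = i") (auto intro!: polys.intros)
next
  case (Sc k)
  then show ?thesis by (auto intro!: polys.intros)
qed

text \<open>The threshold \<open>K\<close> is there for principal open sets: where a polynomial in
  coordinates with indices below \<open>K\<close> is nonzero, only transvections with large indices
  are sure to preserve the set.\<close>

definition tv_stable :: "nat \<Rightarrow> wpt set \<Rightarrow> bool" where
  "tv_stable K Z \<longleftrightarrow> (\<forall>i\<ge>K. \<forall>a\<ge>K. \<forall>t. \<forall>x\<in>Z. i \<noteq> a \<longrightarrow> tv i a t x \<in> Z)"

text \<open>Closedness as separation of outside points by single polynomials, which amounts to being
  cut out in \<open>X\<close> by all polynomials vanishing on \<open>Z\<close>.\<close>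

definition closed_in :: "wpt set \<Rightarrow> wpt set \<Rightarrow> bool" where
  "closed_in X Z \<longleftrightarrow> Z \<subseteq> X \<and> (\<forall>x\<in>X - Z. \<exists>f\<in>polys UNIV. f x \<noteq> 0 \<and> (\<forall>z\<in>Z. f z = 0))"

text \<open>Stated for weakly descending chains, since intersecting a strict chain with a subset
  need not leave it strict.\<close>

definition noeth :: "nat \<Rightarrow> wpt set \<Rightarrow> bool" where
  "noeth K X \<longleftrightarrow> (\<forall>Z. (\<forall>n. closed_in X (Z n) \<and> tv_stable K (Z n) \<and> Z (Suc n) \<subseteq> Z n)
     \<longrightarrow> (\<exists>n C. \<forall>m\<ge>n. Z m = C))"

lemma noethD:
  assumes "noeth K X" "\<And>n. closed_in X (Z n)" "\<And>n. tv_stable K (Z n)" "\<And>n. Z (Suc n) \<subseteq> Z n"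
  shows "\<exists>n C. \<forall>m\<ge>n. Z m = C"
  using assms(1)[unfolded noeth_def, THEN spec, of Z] assms(2-4) by simp

lemma chain_le:
  assumes "\<And>n. Z (Suc n) \<subseteq> Z n" "n \<le> m" shows "Z m \<subseteq> Z (n :: nat)"
  using lift_Suc_antimono_le[of Z, OF assms] .

lemma stable_mono: "tv_stable K Z \<Longrightarrow> K \<le> K' \<Longrightarrow> tv_stable K' Z"
  unfolding tv_stable_def by auto

lemma stable_Int: "tv_stable K Z \<Longrightarrow> tv_stable K Y \<Longrightarrow> tv_stable K (Z \<inter> Y)"
  unfolding tv_stable_def by blast

lemma stableD: "tv_stable K Z \<Longrightarrow> x \<in> Z \<Longrightarrow> K \<le> i \<Longrightarrow> K \<le> a \<Longrightarrow> i \<noteq> a \<Longrightarrow> tv i a t x \<in> Z"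
  unfolding tv_stable_def by blast

lemma closed_in_sub: "closed_in X Z \<Longrightarrow> Z \<subseteq> X"
  unfolding closed_in_def by blast

lemma closed_in_refl: "closed_in X X"
  unfolding closed_in_def by blast

lemma closed_inD:
  assumes "closed_in X Z" "x \<in> X" "x \<notin> Z"
  obtains f where "f \<in> polys UNIV" "f x \<noteq> 0" "\<And>z. z \<in> Z \<Longrightarrow> f z = 0"
  using assms unfolding closed_in_def by blast

lemma closed_inI:
  assumes "Z \<subseteq> X"
    and "\<And>x. x \<in> X \<Longrightarrow> x \<notin> Z \<Longrightarrow> \<exists>f\<in>polys UNIV. f x \<noteq> 0 \<and> (\<forall>z\<in>Z. f z = 0)"
  shows "closed_in X Z"
  using assms unfolding closed_in_def by simp

lemma closed_in_trans:
  assumes XY: "closed_in X Y" and YZ: "closed_in Y Z" shows "closed_in X Z"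
proof (rule closed_inI)
  show "Z \<subseteq> X" using closed_in_sub[OF XY] closed_in_sub[OF YZ] by (rule subset_trans[rotated])
  fix x assume x: "x \<in> X" "x \<notin> Z"
  show "\<exists>f\<in>polys UNIV. f x \<noteq> 0 \<and> (\<forall>z\<in>Z. f z = 0)"
  proof (cases "x \<in> Y")
    case True
    then show ?thesis by (rule closed_inD[OF YZ _ x(2)]) auto
  next
    case False
    then show ?thesis using closed_in_sub[OF YZ] by (rule_tac closed_inD[OF XY x(1)]) auto
  qed
qed

lemma closed_in_subset:
  assumes "closed_in X Z" "Z \<subseteq> Y" "Y \<subseteq> X" shows "closed_in Y Z"
  using assms unfolding closed_in_def by (simp add: subset_iff)

lemma closed_in_Int:
  assumes XZ: "closed_in X Z" and "Y \<subseteq> X" shows "closed_in Y (Z \<inter> Y)"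
proof (rule closed_inI)
  fix x assume "x \<in> Y" "x \<notin> Z \<inter> Y"
  then show "\<exists>f\<in>polys UNIV. f x \<noteq> 0 \<and> (\<forall>z\<in>Z \<inter> Y. f z = 0)"
    using assms(2) by (rule_tac closed_inD[OF XZ, of x]) auto
qed simp

lemma closed_in_zeros:
  assumes "\<And>f. f \<in> A \<Longrightarrow> f \<in> polys UNIV" shows "closed_in X {x\<in>X. \<forall>f\<in>A. f x = 0}"
  unfolding closed_in_def using assms by auto

lemma noeth_closed:
  assumes "noeth K X" "closed_in X Y" shows "noeth K Y"
  unfolding noeth_def
proof (intro allI impI)
  fix Z assume Z: "\<forall>n. closed_in Y (Z n) \<and> tv_stable K (Z n) \<and> Z (Suc n) \<subseteq> Z (n::nat)"
  show "\<exists>n C. \<forall>m\<ge>n. Z m = C"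
    by (rule noethD[OF assms(1)]) (use Z closed_in_trans[OF assms(2)] in blast)+
qed

text \<open>A chain in \<open>W\<close> either stays equal to \<open>W\<close> or has a proper
  member, and all later members form a chain inside that member.\<close>

lemma noeth_if_proper:
  assumes "\<And>X. closed_in W X \<Longrightarrow> tv_stable K X \<Longrightarrow> X \<noteq> W \<Longrightarrow> noeth K X"
  shows "noeth K W"
  unfolding noeth_def
proof (intro allI impI)
  fix Z assume Z: "\<forall>n. closed_in W (Z n) \<and> tv_stable K (Z n) \<and> Z (Suc n) \<subseteq> Z (n::nat)"
  show "\<exists>n C. \<forall>m\<ge>n. Z m = C"
  proof (cases "\<forall>n. Z n = W")
    case False
    then obtain n where "Z n \<noteq> W" by blast
    then have N: "noeth K (Z n)" using assms[of "Z n"] Z by simp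
    have sub: "Z m \<subseteq> Z n" if "n \<le> m" for m using chain_le[of Z, OF _ that] Z by simp
    have cl: "closed_in (Z n) (Z (n + j))" for j
      using Z sub[of "n + j"] closed_in_sub[of W "Z n"] by (rule_tac closed_in_subset[of W]) simp_all
    have "\<exists>m C. \<forall>m'\<ge>m. Z (n + m') = C"
      by (rule noethD[OF N]) (use cl Z in simp_all)
    then obtain m C where m: "\<And>m'. m' \<ge> m \<Longrightarrow> Z (n + m') = C" by blast
    have "Z m' = C" if "m' \<ge> n + m" for m'
      using m[of "m' - n"] that by simp
    then show ?thesis by (intro exI[of _ "n + m"] exI[of _ C]) simp
  next
    case True
    then show ?thesis by (intro exI[of _ 0] exI[of _ W]) simp
  qed
qed

text \<open>Proper inclusion between closed stable sets is well-founded: an infinite strict descent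
  would never become constant.\<close>

lemma noeth_induct:
  assumes "noeth K B"
    and step: "\<And>B'. closed_in B B' \<Longrightarrow> tv_stable K B' \<Longrightarrow>
      (\<And>B''. closed_in B B'' \<Longrightarrow> tv_stable K B'' \<Longrightarrow> B'' \<subset> B' \<Longrightarrow> Q B'') \<Longrightarrow> Q B'"
    and "closed_in B B'" "tv_stable K B'"
  shows "Q B'"
proof -
  let ?r = "{(Y, X). closed_in B X \<and> tv_stable K X \<and> closed_in B Y \<and> tv_stable K Y \<and> Y \<subset> X}"
  have "wf ?r"
    unfolding wf_iff_no_infinite_down_chain
  proof
    assume "\<exists>Z. \<forall>n. (Z (Suc n), Z n) \<in> ?r"
    then obtain Z where Z: "\<forall>n. (Z (Suc n), Z n) \<in> ?r" ..
    have Z': "closed_in B (Z n)" "tv_stable K (Z n)" "Z (Suc n) \<subseteq> Z n" "Z (Suc n) \<noteq> Z n" for n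
      using Z[THEN spec, of n] by auto
    have "\<exists>n C. \<forall>m\<ge>n. Z m = C" by (rule noethD[OF assms(1)]) (fact Z'(1-3))+
    then obtain n C where "\<And>m. m \<ge> n \<Longrightarrow> Z m = C" by blast
    then have "Z (Suc n) = Z n" by (metis le_add2 plus_1_eq_Suc order_refl)
    then show False using Z'(4) by simp
  qed
  then have "closed_in B B' \<longrightarrow> tv_stable K B' \<longrightarrow> Q B'"
  proof (induction B' rule: wf_induct_rule)
    case (less B')
    show ?case
    proof (intro impI)
      assume B': "closed_in B B'" "tv_stable K B'"
      show "Q B'"
      proof (rule step[OF B'])
        fix B'' assume "closed_in B B''" "tv_stable K B''" "B'' \<subset> B'"
        then show "Q B''" using less B' by simp
      qed
    qed
  qed
  then show ?thesis using assms(3,4) by simp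
qed

text \<open>Words in transvections. Letters are added on the inside, so that
  \<open>\<gamma> (tv i a t x)\<close> is again a word applied to \<open>x\<close>; this yields the
  stability of \<open>stable_zeros\<close>.\<close>

inductive_set tv_monoid :: "(wpt \<Rightarrow> wpt) set" where
  one: "(\<lambda>x. x) \<in> tv_monoid"
| step: "\<gamma> \<in> tv_monoid \<Longrightarrow> i \<noteq> a \<Longrightarrow> (\<lambda>x. \<gamma> (tv i a t x)) \<in> tv_monoid"

lemma tv_monoid_stable: "\<gamma> \<in> tv_monoid \<Longrightarrow> tv_stable 0 Z \<Longrightarrow> x \<in> Z \<Longrightarrow> \<gamma> x \<in> Z"
  by (induction arbitrary: x rule: tv_monoid.induct) (auto simp: tv_stable_def)

lemma tv_monoid_stable_iff: "\<gamma> \<in> tv_monoid \<Longrightarrow> tv_stable 0 Z \<Longrightarrow> \<gamma> x \<in> Z \<longleftrightarrow> x \<in> Z"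
proof (induction arbitrary: x rule: tv_monoid.induct)
  case (step \<gamma> i a t)
  have "tv i a t x \<in> Z \<longleftrightarrow> x \<in> Z"
    using step.prems step.hyps tv_inverse[of i a t x] unfolding tv_stable_def
    by (metis zero_le)
  then show ?case using step by blast
qed auto

lemma tv_monoid_polys: "\<gamma> \<in> tv_monoid \<Longrightarrow> f \<in> polys UNIV \<Longrightarrow> (\<lambda>x. f (\<gamma> x)) \<in> polys UNIV"
proof (induction rule: tv_monoid.induct)
  case (step \<gamma> i a t)
  then show ?case using polys_subst[of "\<lambda>x. f (\<gamma> x)" UNIV "tv i a t" UNIV] polys_tv by auto
qed auto

text \<open>The plain zero set of \<open>h\<close> need not be stable. For stable \<open>X\<close>
  this is the largest stable subset of it in \<open>X\<close>, and it is still closed.\<close>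

definition stable_zeros :: "wpt set \<Rightarrow> (wpt \<Rightarrow> complex) \<Rightarrow> wpt set" where
  "stable_zeros X h = {x\<in>X. \<forall>\<gamma>\<in>tv_monoid. h (\<gamma> x) = 0}"

lemma closed_stable_zeros: assumes "h \<in> polys UNIV" shows "closed_in X (stable_zeros X h)"
proof -
  have "stable_zeros X h = {x\<in>X. \<forall>f\<in>(\<lambda>\<gamma> x. h (\<gamma> x)) ` tv_monoid. f x = 0}" by (auto simp: stable_zeros_def)
  moreover have "closed_in X {x\<in>X. \<forall>f\<in>(\<lambda>\<gamma> x. h (\<gamma> x)) ` tv_monoid. f x = 0}"
    by (rule closed_in_zeros) (use tv_monoid_polys assms in blast)
  ultimately show ?thesis by simp
qed

lemma stable_stable_zeros: assumes "tv_stable 0 X" shows "tv_stable 0 (stable_zeros X h)"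
  unfolding tv_stable_def
proof (intro allI ballI impI)
  fix i a :: nat and t x assume x: "x \<in> stable_zeros X h" and ia: "i \<noteq> a"
  have "tv i a t x \<in> X" using x ia assms by (simp add: stable_zeros_def tv_stable_def)
  moreover have "h (\<gamma> (tv i a t x)) = 0" if "\<gamma> \<in> tv_monoid" for \<gamma>
    using x bspec[OF _ tv_monoid.step[OF that ia, of t], of "\<lambda>\<gamma>. h (\<gamma> x) = 0"]
    unfolding stable_zeros_def by simp
  ultimately show "tv i a t x \<in> stable_zeros X h" unfolding stable_zeros_def by blast
qed

text \<open>A chain becomes constant on \<open>X'\<close> and on \<open>Y\<close> separately. Any
  other point can be moved into \<open>Y\<close> by transvections, and moving it does not affect
  membership in a stable set.\<close>

lemma noeth_cover:
  assumes X': "noeth 0 X'" "tv_stable 0 X'" "X' \<subseteq> X"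
    and Y: "noeth K Y" "tv_stable K Y" "Y \<subseteq> X"
    and cov: "\<And>x. x \<in> X - X' \<Longrightarrow> \<exists>\<gamma>\<in>tv_monoid. \<gamma> x \<in> Y"
  shows "noeth 0 X"
  unfolding noeth_def
proof (intro allI impI)
  fix Z assume Z: "\<forall>n. closed_in X (Z n) \<and> tv_stable 0 (Z n) \<and> Z (Suc n) \<subseteq> Z (n::nat)"
  have cl: "closed_in X (Z n)" and st: "tv_stable 0 (Z n)" and de: "Z (Suc n) \<subseteq> Z n" for n
    using Z by simp_all
  have "\<exists>n1 C1. \<forall>m\<ge>n1. Z m \<inter> X' = C1"
  proof (rule noethD[OF X'(1)])
    fix n
    show "closed_in X' (Z n \<inter> X')" by (rule closed_in_Int[OF cl X'(3)])
    show "tv_stable 0 (Z n \<inter> X')" by (rule stable_Int[OF st X'(2)])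
    show "Z (Suc n) \<inter> X' \<subseteq> Z n \<inter> X'" using de[of n] by blast
  qed
  then obtain n1 C1 where n1: "\<And>m. m \<ge> n1 \<Longrightarrow> Z m \<inter> X' = C1" by blast
  have "\<exists>n2 C2. \<forall>m\<ge>n2. Z m \<inter> Y = C2"
  proof (rule noethD[OF Y(1)])
    fix n
    show "closed_in Y (Z n \<inter> Y)" by (rule closed_in_Int[OF cl Y(3)])
    show "tv_stable K (Z n \<inter> Y)" by (rule stable_Int[OF stable_mono[OF st] Y(2)]) simp
    show "Z (Suc n) \<inter> Y \<subseteq> Z n \<inter> Y" using de[of n] by blast
  qed
  then obtain n2 C2 where n2: "\<And>m. m \<ge> n2 \<Longrightarrow> Z m \<inter> Y = C2" by blast
  have "Z m = Z (max n1 n2)" if m: "m \<ge> max n1 n2" for m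
  proof
    show "Z m \<subseteq> Z (max n1 n2)" using chain_le[of Z, OF de m] .
    show "Z (max n1 n2) \<subseteq> Z m"
    proof
      fix x assume x: "x \<in> Z (max n1 n2)"
      show "x \<in> Z m"
      proof (cases "x \<in> X'")
        case True
        have "Z m \<inter> X' = Z (max n1 n2) \<inter> X'" using n1[of m] n1[of "max n1 n2"] m by simp
        then show ?thesis using x True by blast
      next
        case False
        then obtain \<gamma> where g: "\<gamma> \<in> tv_monoid" "\<gamma> x \<in> Y"
          using cov[of x] x closed_in_sub[OF cl] by blast
        have "\<gamma> x \<in> Z (max n1 n2)" using tv_monoid_stable_iff[OF g(1) st] x by simp
        moreover have "Z m \<inter> Y = Z (max n1 n2) \<inter> Y" using n2[of m] n2[of "max n1 n2"] m by simp
        ultimately have "\<gamma> x \<in> Z m" using g(2) by blast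
        then show ?thesis using tv_monoid_stable_iff[OF g(1) st] by simp
      qed
    qed
  qed
  then have "\<forall>m\<ge>max n1 n2. Z m = Z (max n1 n2)" by blast
  then have "\<exists>C. \<forall>m\<ge>max n1 n2. Z m = C" ..
  then show "\<exists>n C. \<forall>m\<ge>n. Z m = C" ..
qed

text \<open>The Zariski closure of the image of a chain is a chain of closed stable sets.\<close>

lemma noeth_transfer:
  fixes \<phi> :: "'a \<Rightarrow> wpt" and Z :: "nat \<Rightarrow> 'a set"
  assumes N: "noeth 0 W" and W: "tv_stable 0 W" and dec: "\<And>n. Z (Suc n) \<subseteq> Z n"
    and im: "\<And>z. z \<in> Z 0 \<Longrightarrow> \<phi> z \<in> W"
    and eq: "\<And>n z i a t. z \<in> Z n \<Longrightarrow> i \<noteq> a \<Longrightarrow> tv i a t (\<phi> z) \<in> \<phi> ` Z n"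
    and sep: "\<And>n z. z \<in> Z 0 \<Longrightarrow> z \<notin> Z n \<Longrightarrow>
      \<exists>f\<in>polys UNIV. f (\<phi> z) \<noteq> 0 \<and> (\<forall>z'\<in>Z n. f (\<phi> z') = 0)"
  shows "\<exists>n C. \<forall>m\<ge>n. Z m = C"
proof -
  define C where "C n = {w\<in>W. \<forall>f\<in>polys UNIV. (\<forall>z\<in>Z n. f (\<phi> z) = 0) \<longrightarrow> f w = 0}" for n
  have sub0: "Z n \<subseteq> Z 0" for n using chain_le[of Z, OF dec, of 0 n] by simp
  \<comment> \<open>By \<open>sep\<close>, passing to the closure adds no image of a point of
    \<open>Z 0\<close>, so \<open>Z n\<close> can be recovered from \<open>C n\<close>.\<close>
  have ZC: "\<phi> z \<in> C n \<longleftrightarrow> z \<in> Z n" if "z \<in> Z 0" for z n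
    using that im sep[of z n] unfolding C_def by blast
  have "\<exists>n C'. \<forall>m\<ge>n. C m = C'"
  proof (rule noethD[OF N])
    fix n
    show "closed_in W (C n)" unfolding C_def closed_in_def by blast
    show "C (Suc n) \<subseteq> C n" unfolding C_def using dec[of n] by blast
    show "tv_stable 0 (C n)"
      unfolding tv_stable_def
    proof (intro allI ballI impI)
      fix i a :: nat and t x assume x: "x \<in> C n" and ia: "i \<noteq> a"
      show "tv i a t x \<in> C n"
        unfolding C_def
      proof (intro CollectI conjI ballI impI)
        show "tv i a t x \<in> W" using x ia W by (auto simp: C_def tv_stable_def)
        fix f assume f: "f \<in> polys UNIV" "\<forall>z\<in>Z n. f (\<phi> z) = 0"
        have x': "\<And>f. f \<in> polys UNIV \<Longrightarrow> \<forall>z\<in>Z n. f (\<phi> z) = 0 \<Longrightarrow> f x = 0"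
          using x by (simp add: C_def)
        \<comment> \<open>Stability of the closure: composing with a transvection turns an equation
          of the image of \<open>Z n\<close> into another one, by \<open>eq\<close>.\<close>
        have p: "(\<lambda>x. f (tv i a t x)) \<in> polys UNIV" by (rule polys_subst[OF f(1) polys_tv])
        have "\<forall>z\<in>Z n. f (tv i a t (\<phi> z)) = 0"
        proof
          fix z assume "z \<in> Z n"
          then obtain z' where "tv i a t (\<phi> z) = \<phi> z'" "z' \<in> Z n" using eq[OF _ ia] by blast
          then show "f (tv i a t (\<phi> z)) = 0" using f(2) by simp
        qed
        then show "f (tv i a t x) = 0" by (rule x'[OF p])
      qed
    qed
  qed
  then obtain n C' where n: "\<And>m. m \<ge> n \<Longrightarrow> C m = C'" by blast
  have "Z m = Z n" if "m \<ge> n" for m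
  proof -
    have "C m = C n" using n[OF that] n[of n] by simp
    then show ?thesis using ZC sub0 by blast
  qed
  then show ?thesis by blast
qed

section \<open>Induction along a fibration\<close>

text \<open>The projection to the base that forgets the fibre coordinates \<open>F\<close>, realised
  inside the same ambient space.\<close>

definition zero_on :: "co set \<Rightarrow> wpt \<Rightarrow> wpt" where
  "zero_on F x = (\<lambda>c. if c \<in> F then 0 else x c)"

lemma tv_monoid_zero_on:
  assumes "\<And>i a t x. tv i a t (zero_on F x) = zero_on F (tv i a t x)" "\<gamma> \<in> tv_monoid"
  shows "\<gamma> (zero_on F x) = zero_on F (\<gamma> x)"
  using assms(2) by (induction arbitrary: x rule: tv_monoid.induct) (simp_all add: assms(1))

text \<open>Scaling the fibre coordinates by \<open>t\<close> joins the projection of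
  \<open>x\<close> at \<open>t = 0\<close> to \<open>x\<close> at \<open>t = 1\<close>, and
  \<open>f\<close> has zero derivative along this line.\<close>

lemma constant_on_fibre:
  assumes f: "f \<in> polys UNIV"
    and D0: "\<And>t. D f (\<lambda>c. if c \<in> F then t * x c else x c) (\<lambda>c. if c \<in> F then x c else 0) = 0"
  shows "f x = f (zero_on F x)"
proof -
  let ?\<gamma> = "\<lambda>t c. if c \<in> F then t * x c else x c"
  have "((\<lambda>t. f (?\<gamma> t)) has_field_derivative 0) (at t)" for t
  proof -
    have "((\<lambda>t. f (?\<gamma> t)) has_field_derivative D f (?\<gamma> t) (\<lambda>c. if c \<in> F then x c else 0)) (at t)"
      by (rule D_chain[OF f]) (auto intro!: derivative_eq_intros)
    then show ?thesis unfolding D0 .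
  qed
  then obtain c where "\<And>t. f (?\<gamma> t) = c"
    using has_field_derivative_zero_constant[of UNIV "\<lambda>t. f (?\<gamma> t)"] by auto
  then have "f (?\<gamma> 1) = f (?\<gamma> 0)" by metis
  moreover have "?\<gamma> 1 = x" "?\<gamma> 0 = zero_on F x" by (auto simp: zero_on_def)
  ultimately show ?thesis by simp
qed

text \<open>The common induction for matrices and vectors. \<open>dirs\<close> are directions along
  the fibre; \<open>span\<close> makes them numerous enough to detect dependence on the fibre, and
  \<open>elim\<close> handles the open part where such a derivative of \<open>f\<close> is
  nonzero.\<close>

lemma noeth_fibration:
  assumes B: "noeth 0 B" "tv_stable 0 B"
    and WB: "\<And>x. x \<in> W \<Longrightarrow> zero_on F x \<in> B"
    and comm: "\<And>i a t x. tv i a t (zero_on F x) = zero_on F (tv i a t x)"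
    and lin: "\<And>x t. x \<in> W \<Longrightarrow> (\<lambda>c. if c \<in> F then t * x c else x c) \<in> W"
    and dirs: "\<And>E c. E \<in> dirs \<Longrightarrow> c \<notin> F \<Longrightarrow> E c = 0"
    and span: "\<And>f x y. f \<in> polys UNIV \<Longrightarrow> x \<in> W \<Longrightarrow> \<forall>E\<in>dirs. D f y E = 0 \<Longrightarrow>
      D f y (\<lambda>c. if c \<in> F then x c else 0) = 0"
    and elim: "\<And>X f E. X \<subseteq> W \<Longrightarrow> tv_stable 0 X \<Longrightarrow> f \<in> polys UNIV \<Longrightarrow> \<forall>x\<in>X. f x = 0 \<Longrightarrow>
      E \<in> dirs \<Longrightarrow> \<exists>K. tv_stable K {x\<in>X. D f x E \<noteq> 0} \<and> noeth K {x\<in>X. D f x E \<noteq> 0}"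
  shows "noeth 0 W"
proof -
  define R where "R B' = {x\<in>W. zero_on F x \<in> B'}" for B'
  have "noeth 0 (R B)"
  proof (rule noeth_induct[OF B(1) _ closed_in_refl B(2)])
    fix B' assume B': "closed_in B B'" "tv_stable 0 B'"
    assume IH: "\<And>B''. closed_in B B'' \<Longrightarrow> tv_stable 0 B'' \<Longrightarrow> B'' \<subset> B' \<Longrightarrow> noeth 0 (R B'')"
    \<comment> \<open>Strong induction on a bound for the fibre degree of an equation
      \<open>f\<close> of \<open>X\<close>, with \<open>X\<close> and \<open>f\<close> arbitrary,
      plays the role of choosing \<open>f\<close> of minimal degree.\<close>
    have main: "noeth 0 X" if "closed_in (R B') X" "tv_stable 0 X" "deg_le F d f" "\<forall>x\<in>X. f x = 0"
      "\<exists>x\<in>R B'. f x \<noteq> 0" for d X f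
      using that
    proof (induction d arbitrary: X f rule: less_induct)
      case (less d)
      have f: "f \<in> polys UNIV" using less.prems(3) by (rule deg_le_polys)
      have XR: "X \<subseteq> R B'" using less.prems(1) by (rule closed_in_sub)
      show ?case
      proof (cases "\<forall>y\<in>R B'. \<forall>E\<in>dirs. D f y E = 0")
        case True
        have fz: "f x = f (zero_on F x)" if "x \<in> R B'" for x
        proof (rule constant_on_fibre[OF f])
          fix t
          have "(\<lambda>c. if c \<in> F then t * x c else x c) \<in> R B'"
            using that lin[of x t] unfolding R_def zero_on_def by (simp add: if_distrib cong: if_cong)
          then show "D f (\<lambda>c. if c \<in> F then t * x c else x c) (\<lambda>c. if c \<in> F then x c else 0) = 0"
            using that True unfolding R_def by (intro span[OF f]) blast+
        qed
        \<comment> \<open>Here \<open>f\<close> is a function on the base. Its stable zeros there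
          form a proper subset of \<open>B'\<close>, because \<open>f\<close> is nonzero at some
          point over \<open>B'\<close>; it remains to see that \<open>X\<close> lies over
          them.\<close>
        define B'' where "B'' = stable_zeros B' f"
        obtain x0 where x0: "x0 \<in> R B'" "f x0 \<noteq> 0" using less.prems(5) by blast
        have "zero_on F x0 \<in> B'" "f (zero_on F x0) \<noteq> 0" using x0 fz[OF x0(1)] by (simp_all add: R_def)
        then have "zero_on F x0 \<in> B' - B''"
          unfolding B''_def stable_zeros_def using tv_monoid.one by auto
        moreover have "B'' \<subseteq> B'" unfolding B''_def stable_zeros_def by blast
        ultimately have "B'' \<subset> B'" by blast
        moreover have "closed_in B B''"
          unfolding B''_def by (rule closed_in_trans[OF B'(1) closed_stable_zeros[OF f]])
        moreover have "tv_stable 0 B''" unfolding B''_def by (rule stable_stable_zeros[OF B'(2)])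
        ultimately have N: "noeth 0 (R B'')" by (intro IH)
        have "X \<subseteq> R B''"
        proof
          fix x assume x: "x \<in> X"
          have "f (\<gamma> (zero_on F x)) = 0" if g: "\<gamma> \<in> tv_monoid" for \<gamma>
          proof -
            have gx: "\<gamma> x \<in> X" by (rule tv_monoid_stable[OF g less.prems(2) x])
            then have "f (zero_on F (\<gamma> x)) = 0" using fz[of "\<gamma> x"] XR less.prems(4) by auto
            then show ?thesis using tv_monoid_zero_on[OF comm g] by simp
          qed
          then show "x \<in> R B''" using x XR unfolding R_def B''_def stable_zeros_def by blast
        qed
        moreover have "R B'' \<subseteq> R B'" using \<open>B'' \<subseteq> B'\<close> unfolding R_def by blast
        ultimately have "closed_in (R B'') X" by (rule closed_in_subset[OF less.prems(1)])
        then show ?thesis by (rule noeth_closed[OF N])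
      next
        case False
        \<comment> \<open>The point \<open>y\<close> shows that the derivative does not vanish on
          all of \<open>R B'\<close>. It is therefore an admissible equation of smaller degree for
          \<open>stable_zeros X ?h\<close>.\<close>
        then obtain y E where y: "y \<in> R B'" "E \<in> dirs" "D f y E \<noteq> 0" by blast
        let ?h = "\<lambda>x. D f x E"
        have E: "\<And>c. c \<notin> F \<Longrightarrow> E c = 0" using dirs y(2) by blast
        have pdh: "deg_le F (d - 1) ?h" and d: "d \<noteq> 0"
          using deg_le_D[of F d f E, OF less.prems(3)] E y(3) by blast+
        have h: "?h \<in> polys UNIV" using pdh by (rule deg_le_polys)
        let ?Y = "{x\<in>X. ?h x \<noteq> 0}"
        have "X \<subseteq> W" using XR unfolding R_def by blast
        then obtain K where K: "tv_stable K ?Y" "noeth K ?Y"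
          using elim[OF _ less.prems(2) f less.prems(4) y(2)] by blast
        have X': "stable_zeros X ?h \<subseteq> X" "\<forall>x\<in>stable_zeros X ?h. ?h x = 0"
          unfolding stable_zeros_def using tv_monoid.one by auto
        have "noeth 0 (stable_zeros X ?h)"
        proof (rule less.IH[OF _ _ _ pdh X'(2)])
          show "d - 1 < d" using d by simp
          show "closed_in (R B') (stable_zeros X ?h)"
            by (rule closed_in_trans[OF less.prems(1) closed_stable_zeros[OF h]])
          show "tv_stable 0 (stable_zeros X ?h)" by (rule stable_stable_zeros[OF less.prems(2)])
          show "\<exists>x\<in>R B'. ?h x \<noteq> 0" using y by blast
        qed
        then show ?thesis
        proof (rule noeth_cover[OF _ stable_stable_zeros[OF less.prems(2)] X'(1) K(2,1)])
          fix x assume x: "x \<in> X - stable_zeros X ?h"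
          then obtain \<gamma> where g: "\<gamma> \<in> tv_monoid" "?h (\<gamma> x) \<noteq> 0" unfolding stable_zeros_def by blast
          moreover have "\<gamma> x \<in> X" using tv_monoid_stable[OF g(1) less.prems(2)] x by blast
          ultimately show "\<exists>\<gamma>\<in>tv_monoid. \<gamma> x \<in> ?Y" by blast
        qed blast
      qed
    qed
    show "noeth 0 (R B')"
    proof (rule noeth_if_proper)
      fix X assume X: "closed_in (R B') X" "tv_stable 0 X" "X \<noteq> R B'"
      then obtain x where x: "x \<in> R B'" "x \<notin> X" using closed_in_sub by blast
      obtain f where f: "f \<in> polys UNIV" "f x \<noteq> 0" "\<And>z. z \<in> X \<Longrightarrow> f z = 0"
        using closed_inD[OF X(1) x] by blast
      obtain d where "deg_le F d f" using polys_deg_le[OF f(1)] by blast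
      then show "noeth 0 X" using main[OF X(1,2)] f x by blast
    qed
  qed
  moreover have "R B = W" using WB unfolding R_def by blast
  ultimately show ?thesis by simp
qed

section \<open>The ambient spaces\<close>

definition eps :: "nat \<Rightarrow> complex" where "eps k = (if even k then 1 else - 1)"

lemma eps_sq [simp]: "eps k * eps k = 1" "eps k * (eps k * z) = z"
  by (simp_all add: eps_def)

text \<open>Components are named by index sets and are zero outside them, so that spaces with fewer
  matrices, vectors or scalars are subsets of spaces with more.\<close>

definition W :: "nat set \<Rightarrow> nat list set \<Rightarrow> nat list set \<Rightarrow> wpt set" where
  "W P N M = {x. (\<forall>k i j. x (Mc k j i) = eps k * x (Mc k i j))
     \<and> (\<forall>k i j. k \<notin> P \<longrightarrow> x (Mc k i j) = 0) \<and> (\<forall>k i. k \<notin> N \<longrightarrow> x (Vc k i) = 0)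
     \<and> (\<forall>k. k \<notin> M \<longrightarrow> x (Sc k) = 0)}"

lemma W_sym: "x \<in> W P N M \<Longrightarrow> x (Mc k j i) = eps k * x (Mc k i j)"
  unfolding W_def by blast

lemma W_out:
  assumes "x \<in> W P N M"
  shows "k \<notin> P \<Longrightarrow> x (Mc k i j) = 0" "ks \<notin> N \<Longrightarrow> x (Vc ks i) = 0" "ks \<notin> M \<Longrightarrow> x (Sc ks) = 0"
  using assms unfolding W_def by blast+

lemma W_I:
  assumes "\<And>k i j. x (Mc k j i) = eps k * x (Mc k i j)"
    and "\<And>k i j. k \<notin> P \<Longrightarrow> x (Mc k i j) = 0" "\<And>ks i. ks \<notin> N \<Longrightarrow> x (Vc ks i) = 0"
    and "\<And>ks. ks \<notin> M \<Longrightarrow> x (Sc ks) = 0"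
  shows "x \<in> W P N M"
  unfolding W_def by (intro CollectI conjI allI impI assms)

lemma stable_W: "tv_stable K (W P N M)"
  unfolding tv_stable_def
proof (intro allI ballI impI)
  fix i a :: nat and t x assume x: "x \<in> W P N M"
  have "tv i a t x (Mc k m l) = eps k * tv i a t x (Mc k l m)" for k l m
  proof -
    \<comment> \<open>This handles the quadratic term of the transvection; for a skew-symmetric
      matrix it says that the diagonal entry is zero.\<close>
    have "eps k * x (Mc k a a) = x (Mc k a a)" using W_sym[OF x, of k a a] by simp
    then show ?thesis
      unfolding tv.simps W_sym[OF x, of k m l] W_sym[OF x, of k a l] W_sym[OF x, of k m a]
      by (simp add: distrib_left mult.left_commute)
  qed
  moreover have "k \<notin> P \<Longrightarrow> tv i a t x (Mc k l m) = 0" "ks \<notin> N \<Longrightarrow> tv i a t x (Vc ks l) = 0"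
    "ks \<notin> M \<Longrightarrow> tv i a t x (Sc ks) = 0" for k l m ks
    by (simp_all add: W_out[OF x])
  ultimately show "tv i a t x \<in> W P N M" unfolding W_def by blast
qed

text \<open>Derivative at \<open>t = 0\<close> of the transvections.\<close>

fun xi :: "nat \<Rightarrow> nat \<Rightarrow> wpt \<Rightarrow> wpt" where
  "xi i a x (Mc k l m) = (if l = i then x (Mc k a m) else 0) + (if m = i then x (Mc k l a) else 0)"
| "xi i a x (Vc k l) = (if l = i then x (Vc k a) else 0)"
| "xi i a x (Sc k) = 0"

text \<open>Stability keeps the curve \<open>tv i a t x\<close> inside \<open>X\<close>, where
  \<open>f\<close> is zero; differentiate at \<open>t = 0\<close>. So the derivation
  \<open>xi i a\<close> maps equations of \<open>X\<close> to equations of \<open>X\<close>.\<close>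

lemma D_xi_eq_0:
  assumes f: "f \<in> polys UNIV" and X: "tv_stable 0 X" "\<forall>x\<in>X. f x = 0" and x: "x \<in> X" and ia: "i \<noteq> a"
  shows "D f x (xi i a x) = 0"
proof -
  have "((\<lambda>t. tv i a t x u) has_field_derivative xi i a x u) (at 0)" for u
  proof (cases u)
    case (Mc k l m)
    then show ?thesis
      by (cases "l = i"; cases "m = i") (auto intro!: derivative_eq_intros)
  next
    case (Vc k l)
    then show ?thesis by (cases "l = i") (auto intro!: derivative_eq_intros)
  qed simp
  then have "((\<lambda>t. f (tv i a t x)) has_field_derivative D f (tv i a 0 x) (xi i a x)) (at 0)"
    by (intro D_chain[OF f])
  moreover have "f (tv i a t x) = 0" for t
    using X(2) stableD[OF X(1) x _ _ ia] by simp
  ultimately have "((\<lambda>t::complex. 0::complex) has_field_derivative D f x (xi i a x)) (at 0)"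
    by (simp add: tv_zero)
  then show ?thesis using DERIV_unique DERIV_const by blast
qed

section \<open>Eliminating coordinates over a principal open subset\<close>

fun low :: "nat \<Rightarrow> co \<Rightarrow> bool" where
  "low K (Mc k l m) \<longleftrightarrow> l < K \<and> m < K"
| "low K (Vc k l) \<longleftrightarrow> l < K"
| "low K (Sc k) \<longleftrightarrow> True"

text \<open>What remains after discarding, for matrices outside \<open>P\<close> and vectors outside
  \<open>N\<close>, all entries whose indices are all at least \<open>K\<close>.\<close>

fun kept :: "nat \<Rightarrow> nat set \<Rightarrow> nat list set \<Rightarrow> co \<Rightarrow> bool" where
  "kept K P N (Mc k l m) \<longleftrightarrow> k \<in> P \<or> l < K \<or> m < K"
| "kept K P N (Vc k l) \<longleftrightarrow> k \<in> N \<or> l < K"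
| "kept K P N (Sc k) \<longleftrightarrow> True"

lemma low_kept: "low K u \<Longrightarrow> kept K P N u"
  by (cases u) auto

lemma low_mono: "low K u \<Longrightarrow> K \<le> K' \<Longrightarrow> low K' u"
  by (cases u) auto

lemma polys_low: "f \<in> polys U \<Longrightarrow> \<exists>K. f \<in> polys {u. low K u}"
proof (induction rule: polys.induct)
  case (const a)
  then show ?case by (intro exI polys.const)
next
  case (coord u)
  have "\<exists>K. low K u"
  proof (cases u)
    case (Mc k l m)
    then show ?thesis by (intro exI[of _ "Suc (max l m)"]) auto
  qed auto
  then show ?case by (auto intro: polys.coord)
next
  case (add f g)
  then obtain K K' where "f \<in> polys {u. low K u}" "g \<in> polys {u. low K' u}" by blast
  then have "f \<in> polys {u. low (max K K') u}" "g \<in> polys {u. low (max K K') u}"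
    by (auto elim!: polys_mono intro: low_mono)
  then show ?case by (blast intro: polys.add)
next
  case (mult f g)
  then obtain K K' where "f \<in> polys {u. low K u}" "g \<in> polys {u. low K' u}" by blast
  then have "f \<in> polys {u. low (max K K') u}" "g \<in> polys {u. low (max K K') u}"
    by (auto elim!: polys_mono intro: low_mono)
  then show ?case by (blast intro: polys.mult)
qed

lemma tv_low:
  assumes "f \<in> polys {u. low K u}" "K \<le> i" shows "f (tv i a t x) = f x"
proof (rule polys_cong[OF assms(1)])
  fix u assume "u \<in> {u. low K u}"
  then show "tv i a t x u = x u" using assms(2) by (cases u) auto
qed

lemma stable_open:
  assumes "tv_stable 0 X" "h \<in> polys {u. low K u}" shows "tv_stable K {x\<in>X. h x \<noteq> 0}"
  using assms(1) tv_low[OF assms(2)] unfolding tv_stable_def by auto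

text \<open>The first \<open>K\<close> rows of the matrices become vectors; entries with all indices below
  \<open>K\<close> and the inverse of \<open>h\<close> become scalars.\<close>

fun slice :: "nat \<Rightarrow> nat set \<Rightarrow> nat list set \<Rightarrow> (wpt \<Rightarrow> complex) \<Rightarrow> wpt \<Rightarrow> wpt" where
  "slice K P N h y (Mc k l m) = (if k \<in> P then y (Mc k (l + K) (m + K)) else 0)"
| "slice K P N h y (Vc (0 # ks) l) = (if ks \<in> N then y (Vc ks (l + K)) else 0)"
| "slice K P N h y (Vc [Suc 0, k, j] l) = (if j < K then y (Mc k j (l + K)) else 0)"
| "slice K P N h y (Vc ks l) = 0"
| "slice K P N h y (Sc []) = inverse (h y)"
| "slice K P N h y (Sc (0 # ks)) = y (Sc ks)"
| "slice K P N h y (Sc [Suc 0, k, l, m]) = (if l < K \<and> m < K then y (Mc k l m) else 0)"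
| "slice K P N h y (Sc (Suc (Suc 0) # l # ks)) = (if l < K then y (Vc ks l) else 0)"
| "slice K P N h y (Sc ks) = 0"

text \<open>The head of a list records the origin: 0 for an old vector or scalar, 1 for a piece of a
  matrix, 2 for a vector entry; the empty list names the inverse of \<open>h\<close>. An eliminated
  matrix still contributes its first \<open>K\<close> rows, an eliminated vector its first
  \<open>K\<close> entries.\<close>

definition slice_vecs :: "nat \<Rightarrow> nat set \<Rightarrow> nat list set \<Rightarrow> nat list set" where
  "slice_vecs K P N = (#) 0 ` N \<union> (\<lambda>(k, j). [Suc 0, k, j]) ` (P \<times> {..<K})"

definition slice_scals :: "nat \<Rightarrow> nat set \<Rightarrow> nat list set \<Rightarrow> nat list set \<Rightarrow> nat list set" where
  "slice_scals K P N M = insert [] ((#) 0 ` M \<union> (\<lambda>(k, l, m). [Suc 0, k, l, m]) ` (P \<times> {..<K} \<times> {..<K})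
     \<union> (\<lambda>(ks, l). Suc (Suc 0) # l # ks) ` (N \<times> {..<K}))"

lemma finite_slice:
  "finite P \<Longrightarrow> finite N \<Longrightarrow> finite (slice_vecs K P N)"
  "finite P \<Longrightarrow> finite N \<Longrightarrow> finite M \<Longrightarrow> finite (slice_scals K P N M)"
  unfolding slice_vecs_def slice_scals_def by auto

lemma slice_in_W:
  assumes y: "y \<in> W P' N' M"
  shows "slice K P N h y \<in> W P (slice_vecs K P' N) (slice_scals K P' N' M)"
proof -
  have "slice K P N h y (Vc ks l) = 0" if "ks \<notin> slice_vecs K P' N" for ks l
    using that
    by (cases "(K, P, N, h, y, Vc ks l)" rule: slice.cases)
      (auto simp: slice_vecs_def image_iff W_out[OF y])
  moreover have "slice K P N h y (Sc ks) = 0" if "ks \<notin> slice_scals K P' N' M" for ks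
    using that
    by (cases "(K, P, N, h, y, Sc ks)" rule: slice.cases)
      (auto simp: slice_scals_def image_iff W_out[OF y])
  moreover have "slice K P N h y (Mc k j i) = eps k * slice K P N h y (Mc k i j)" for k i j
    using W_sym[OF y, of k "j + K" "i + K"] by simp
  moreover have "slice K P N h y (Mc k i j) = 0" if "k \<notin> P" for k i j
    using that by simp
  ultimately show ?thesis
    unfolding W_def by (intro CollectI conjI allI impI)
qed

text \<open>Indices are shifted by \<open>K\<close>, so the transvections with indices at least
  \<open>K\<close> become all transvections of the slice. Invariance of \<open>h\<close> takes care
  of the coordinate holding its inverse.\<close>

lemma tv_slice:
  assumes "h (tv (i + K) (a + K) t y) = h y"
  shows "tv i a t (slice K P N h y) = slice K P N h (tv (i + K) (a + K) t y)"
proof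
  fix u
  show "tv i a t (slice K P N h y) u = slice K P N h (tv (i + K) (a + K) t y) u"
    by (cases "(K, P, N, h, y, u)" rule: slice.cases) (simp_all add: assms)
qed

lemma polys_pullback:
  assumes f: "f \<in> polys U"
    and c: "\<And>u. u \<in> U \<Longrightarrow> \<exists>G\<in>polys V. \<forall>y\<in>Y. y u = G (\<phi> y)"
  shows "\<exists>G\<in>polys V. \<forall>y\<in>Y. f y = G (\<phi> y)"
proof -
  obtain G where G: "\<And>u. u \<in> U \<Longrightarrow> G u \<in> polys V" "\<And>u y. u \<in> U \<Longrightarrow> y \<in> Y \<Longrightarrow> y u = G u (\<phi> y)"
    using c by metis
  have "(\<lambda>w. f (\<lambda>u. G u w)) \<in> polys V"
    by (rule polys_subst[OF f]) (simp add: G(1))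
  moreover have "f y = f (\<lambda>u. G u (\<phi> y))" if "y \<in> Y" for y
    by (rule polys_cong[OF f]) (simp add: G(2) that)
  ultimately show ?thesis by (rule_tac bexI[of _ "\<lambda>w. f (\<lambda>u. G u w)"]) simp_all
qed

lemma kept_pullback:
  assumes u: "kept K P N u" and Y: "Y \<subseteq> W P' N' M"
  shows "\<exists>G\<in>polys UNIV. \<forall>y\<in>Y. y u = G (slice K P N h y)"
proof (cases u)
  case (Sc ks)
  show ?thesis
    by (rule bexI[of _ "\<lambda>w. w (Sc (0 # ks))"]) (auto simp: Sc intro: polys.coord)
next
  case (Vc ks l)
  show ?thesis
  proof (cases "l < K")
    case True
    then show ?thesis
      by (intro bexI[of _ "\<lambda>w. w (Sc (Suc (Suc 0) # l # ks))"]) (auto simp: Vc intro: polys.coord)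
  next
    case False
    then show ?thesis using u
      by (intro bexI[of _ "\<lambda>w. w (Vc (0 # ks) (l - K))"]) (auto simp: Vc intro: polys.coord)
  qed
next
  case (Mc k l m)
  consider "l < K" "m < K" | "l < K" "\<not> m < K" | "\<not> l < K" "m < K" | "k \<in> P" "\<not> l < K" "\<not> m < K"
    using u Mc by auto
  then show ?thesis
  proof cases
    case 1
    then show ?thesis
      by (intro bexI[of _ "\<lambda>w. w (Sc [Suc 0, k, l, m])"]) (auto simp: Mc intro: polys.coord)
  next
    case 2
    then show ?thesis
      by (intro bexI[of _ "\<lambda>w. w (Vc [Suc 0, k, l] (m - K))"]) (auto simp: Mc intro: polys.coord)
  next
    case 3
    \<comment> \<open>Only the low rows are stored; an entry in a low column is read off from a row
      by symmetry.\<close>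
    have "y u = eps k * slice K P N h y (Vc [Suc 0, k, m] (l - K))" if "y \<in> Y" for y
      using 3 W_sym[of y P' N' M k m l] Y that by (auto simp: Mc)
    then show ?thesis
      by (rule_tac bexI[of _ "\<lambda>w. eps k * w (Vc [Suc 0, k, m] (l - K))"])
        (blast, intro polys_cmult polys.coord UNIV_I)
  next
    case 4
    then show ?thesis
      by (intro bexI[of _ "\<lambda>w. w (Mc k (l - K) (m - K))"]) (auto simp: Mc intro: polys.coord)
  qed
qed

text \<open>Dividing the relations \<open>elim\<close> by \<open>h\<close> makes every coordinate on
  \<open>Y\<close> a polynomial in the slice. So slicing is an equivariant embedding that induces
  the Zariski topology of \<open>Y\<close>, and chains can be transferred to the smaller
  space.\<close>

lemma noeth_elim:
  assumes N: "noeth 0 (W P (slice_vecs K P' N) (slice_scals K P' N' M))"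
    and Y: "tv_stable K Y" "Y \<subseteq> W P' N' M"
    and h: "h \<in> polys {u. low K u}" "\<And>y. y \<in> Y \<Longrightarrow> h y \<noteq> 0"
    and elim: "\<And>u. \<not> kept K P N u \<Longrightarrow> \<exists>F\<in>polys {u. kept K P N u}. \<forall>y\<in>Y. h y * y u = F y"
  shows "noeth K Y"
proof -
  let ?\<phi> = "slice K P N h"
  have pk: "\<exists>G\<in>polys UNIV. \<forall>y\<in>Y. F y = G (?\<phi> y)" if "F \<in> polys {u. kept K P N u}" for F
    by (rule polys_pullback[OF that]) (use kept_pullback[OF _ Y(2)] in blast)
  have pu: "\<exists>G\<in>polys UNIV. \<forall>y\<in>Y. y u = G (?\<phi> y)" for u
  proof (cases "kept K P N u")
    case True
    then show ?thesis by (rule kept_pullback[OF _ Y(2)])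
  next
    case False
    then obtain F where F: "F \<in> polys {u. kept K P N u}" "\<forall>y\<in>Y. h y * y u = F y" using elim by blast
    obtain G where G: "G \<in> polys UNIV" "\<forall>y\<in>Y. F y = G (?\<phi> y)" using pk[OF F(1)] by blast
    have "y u = ?\<phi> y (Sc []) * G (?\<phi> y)" if "y \<in> Y" for y
    proof -
      have "h y * y u = G (?\<phi> y)" using F(2) G(2) that by simp
      then show ?thesis using h(2)[OF that] by (simp add: field_simps)
    qed
    moreover have "(\<lambda>w. w (Sc []) * G w) \<in> polys UNIV" by (intro polys.mult polys.coord G(1) UNIV_I)
    ultimately show ?thesis by (rule_tac bexI[of _ "\<lambda>w. w (Sc []) * G w"]) simp_all
  qed
  show ?thesis
    unfolding noeth_def
  proof (intro allI impI)
    fix Z assume "\<forall>n. closed_in Y (Z n) \<and> tv_stable K (Z n) \<and> Z (Suc n) \<subseteq> Z (n::nat)"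
    then have cl: "closed_in Y (Z n)" and st: "tv_stable K (Z n)" and de: "Z (Suc n) \<subseteq> Z n" for n
      by simp_all
    have ZY: "z \<in> Z n \<Longrightarrow> z \<in> Y" for z n using closed_in_sub[OF cl] by blast
    show "\<exists>n C. \<forall>m\<ge>n. Z m = C"
    proof (rule noeth_transfer[OF N stable_W, where \<phi> = ?\<phi>])
      fix n show "Z (Suc n) \<subseteq> Z n" by (rule de)
    next
      fix z assume "z \<in> Z 0"
      then show "?\<phi> z \<in> W P (slice_vecs K P' N) (slice_scals K P' N' M)"
        using slice_in_W ZY Y(2) by blast
    next
      fix n z i a t assume z: "z \<in> Z n" and "i \<noteq> (a::nat)"
      then have "tv (i + K) (a + K) t z \<in> Z n" using stableD[OF st z] by simp
      moreover have "tv i a t (?\<phi> z) = ?\<phi> (tv (i + K) (a + K) t z)"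
        by (rule tv_slice) (rule tv_low[OF h(1)], simp)
      ultimately show "tv i a t (?\<phi> z) \<in> ?\<phi> ` Z n" by simp
    next
      fix n z assume z: "z \<in> Z 0" "z \<notin> Z n"
      obtain f where f: "f \<in> polys UNIV" "f z \<noteq> 0" "\<And>z'. z' \<in> Z n \<Longrightarrow> f z' = 0"
        using closed_inD[OF cl ZY[OF z(1)] z(2)] by blast
      obtain G where G: "G \<in> polys UNIV" "\<forall>y\<in>Y. f y = G (?\<phi> y)"
        using polys_pullback[OF f(1), of UNIV Y ?\<phi>] pu by blast
      have "G (?\<phi> z) \<noteq> 0" using G(2) f(2) ZY[OF z(1)] by force
      moreover have "\<forall>z'\<in>Z n. G (?\<phi> z') = 0" using G(2) f(3) ZY by force
      ultimately show "\<exists>f\<in>polys UNIV. f (?\<phi> z) \<noteq> 0 \<and> (\<forall>z'\<in>Z n. f (?\<phi> z') = 0)"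
        using G(1) by blast
    qed
  qed
qed

section \<open>Eliminating a matrix\<close>

text \<open>The direction \<open>E_{i,j} + eps k E_{j,i}\<close>, tangent to the symmetric or
  skew-symmetric matrices. For \<open>i = j\<close> it is twice a matrix unit or zero.\<close>

fun Edir :: "nat \<Rightarrow> nat \<Rightarrow> nat \<Rightarrow> wpt" where
  "Edir k i j (Mc k' l m) = (if k' = k then (if l = i \<and> m = j then 1 else 0)
     + (if l = j \<and> m = i then eps k else 0) else 0)"
| "Edir k i j (Vc _ _) = 0"
| "Edir k i j (Sc _) = 0"

text \<open>The part of \<open>xi i a (xi j b x)\<close> that involves entries with both indices at least \<open>K\<close>,
  for \<open>i, j < K \<le> a, b\<close>.\<close>

fun eta :: "nat \<Rightarrow> nat \<Rightarrow> nat \<Rightarrow> nat \<Rightarrow> wpt \<Rightarrow> wpt" where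
  "eta i j a b x (Mc k l m) = (if l = i \<and> m = j then x (Mc k a b) else 0)
     + (if m = i \<and> l = j then x (Mc k b a) else 0)"
| "eta i j a b x (Vc _ _) = 0"
| "eta i j a b x (Sc _) = 0"

lemma D_xi: "D (\<lambda>y. xi i a y u) x z = xi i a z u"
proof (cases u)
  case (Mc k l m)
  have "D (\<lambda>y. y (Mc k a m) + y (Mc k l a)) x z = z (Mc k a m) + z (Mc k l a)"
    by (subst D_add[of _ UNIV]) (auto intro: polys.coord)
  then show ?thesis using Mc by (cases "l = i"; cases "m = i") simp_all
next
  case (Vc k l)
  then show ?thesis by (cases "l = i") simp_all
qed simp

text \<open>Replacing one of two low indices by \<open>a\<close> leaves the other one low, so no
  matrix entry with both indices large occurs.\<close>

lemma polys_xi: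
  assumes "low K u" shows "(\<lambda>x. xi i a x u) \<in> polys {u. kept K {} UNIV u}"
proof (cases u)
  case (Mc k l m)
  have "(\<lambda>x. if P then x (Mc k a m) else 0) \<in> polys {u. kept K {} UNIV u}"
    "(\<lambda>x. if P then x (Mc k l a) else 0) \<in> polys {u. kept K {} UNIV u}" for P
    using assms Mc by (cases P; auto intro: polys.intros)+
  then show ?thesis unfolding Mc xi.simps by (intro polys.add)
next
  case (Vc k l)
  then show ?thesis by (cases "l = i") (auto intro: polys.intros)
qed (simp add: polys.const)

text \<open>An entry with both indices large can arise only when the two derivations hit the two
  indices of one coordinate, which is what \<open>eta\<close> records. The cross terms of the
  product rule are products of first derivatives and so involve kept coordinates only.\<close>

lemma second_derivative:
  assumes f: "f \<in> polys {u. low K u}" and ij: "i < K" "j < K" "K \<le> a" "K \<le> b"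
  shows "(\<lambda>x. D (\<lambda>y. D f y (xi i a y)) x (xi j b x) - D f x (eta i j a b x))
    \<in> polys {u. kept K {} UNIV u}"
  using f
proof (induction rule: polys.induct)
  case (const c)
  then show ?case by (simp add: polys.const)
next
  case (coord u)
  then have "xi i a (xi j b x) u = eta i j a b x u" for x
  proof (cases u)
    case (Mc k l m)
    \<comment> \<open>Since \<open>a\<close> is large, it is neither \<open>j\<close> nor an index
      of \<open>u\<close>; hence the second derivation cannot act on the index that the first one
      has produced.\<close>
    then have "l \<noteq> a" "m \<noteq> a" "a \<noteq> j" using coord ij by auto
    then show ?thesis unfolding Mc
      by (cases "l = i"; cases "m = i"; cases "l = j"; cases "m = j") simp_all
  next
    case (Vc k l)
    then show ?thesis using ij by simp
  qed simp
  then show ?case by (simp add: D_xi polys.const)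
next
  case (add f g)
  have A: "(\<lambda>y. D f y (xi i a y)) \<in> polys {u. kept K {} UNIV u}" if "f \<in> polys {u. low K u}" for f
    by (rule polys_D[OF that]) (auto intro: low_kept polys_xi)
  have e: "(\<lambda>y. D (\<lambda>x. f x + g x) y (xi i a y)) = (\<lambda>y. D f y (xi i a y) + D g y (xi i a y))"
    using add.hyps by simp
  have "(\<lambda>x. D (\<lambda>y. D (\<lambda>x. f x + g x) y (xi i a y)) x (xi j b x) - D (\<lambda>x. f x + g x) x (eta i j a b x))
    = (\<lambda>x. (D (\<lambda>y. D f y (xi i a y)) x (xi j b x) - D f x (eta i j a b x))
         + (D (\<lambda>y. D g y (xi i a y)) x (xi j b x) - D g x (eta i j a b x)))"
    unfolding e D_add[OF A[OF add.hyps(1)] A[OF add.hyps(2)]] D_add[OF add.hyps] by auto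
  then show ?case using polys.add[OF add.IH] by simp
next
  case (mult f g)
  let ?M = "polys {u. kept K {} UNIV u}"
  have A: "(\<lambda>y. D f y (xi i a y)) \<in> ?M" if "f \<in> polys {u. low K u}" for f i a
    by (rule polys_D[OF that]) (auto intro: low_kept polys_xi)
  have m: "f \<in> ?M" if "f \<in> polys {u. low K u}" for f
    by (rule polys_mono[OF that]) (auto intro: low_kept)
  note Af = A[OF mult.hyps(1)] and Ag = A[OF mult.hyps(2)]
  note mf = m[OF mult.hyps(1)] and mg = m[OF mult.hyps(2)]
  have e: "(\<lambda>y. D (\<lambda>x. f x * g x) y (xi i a y))
    = (\<lambda>y. D f y (xi i a y) * g y + D g y (xi i a y) * f y)"
    using mult.hyps by simp
  have "(\<lambda>x. D (\<lambda>y. D (\<lambda>x. f x * g x) y (xi i a y)) x (xi j b x) - D (\<lambda>x. f x * g x) x (eta i j a b x))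
    = (\<lambda>x. ((D (\<lambda>y. D f y (xi i a y)) x (xi j b x) - D f x (eta i j a b x)) * g x
         + (D (\<lambda>y. D g y (xi i a y)) x (xi j b x) - D g x (eta i j a b x)) * f x)
         + (D g x (xi j b x) * D f x (xi i a x) + D f x (xi j b x) * D g x (xi i a x)))"
    unfolding e D_add[OF polys.mult[OF Af mg] polys.mult[OF Ag mf]] D_mult[OF Af mg] D_mult[OF Ag mf]
      D_mult[OF mult.hyps]
    by (auto simp: algebra_simps)
  moreover have "\<dots> \<in> ?M" by (intro polys.add polys.mult mult.IH Af Ag mf mg)
  ultimately show ?case by simp
qed

text \<open>The symmetry of \<open>x\<close> turns the entry \<open>(b, a)\<close> into
  \<open>eps k\<close> times the entry \<open>(a, b)\<close>, so both terms of \<open>eta\<close>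
  share one coefficient.\<close>

lemma eta_W:
  assumes "x \<in> W P N M" "finite P"
  shows "eta i j a b x = (\<lambda>u. \<Sum>k\<in>P. x (Mc k a b) * Edir k i j u)"
proof
  fix u
  show "eta i j a b x u = (\<Sum>k\<in>P. x (Mc k a b) * Edir k i j u)"
  proof (cases u)
    case (Mc k l m)
    have "(\<Sum>k'\<in>P. x (Mc k' a b) * Edir k' i j u)
      = (\<Sum>k'\<in>P. if k' = k then x (Mc k a b) * Edir k i j u else 0)"
      by (rule sum.cong) (auto simp: Mc)
    also have "\<dots> = (if k \<in> P then x (Mc k a b) * Edir k i j u else 0)"
      using assms(2) by (simp add: sum.delta)
    also have "\<dots> = eta i j a b x u"
    proof (cases "k \<in> P")
      case True
      have s: "x (Mc k b a) = eps k * x (Mc k a b)" by (rule W_sym[OF assms(1)])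
      have "x (Mc k a b) * ((if l = i \<and> m = j then 1 else 0) + (if l = j \<and> m = i then eps k else 0))
        = (if l = i \<and> m = j then x (Mc k a b) else 0) + (if m = i \<and> l = j then eps k * x (Mc k a b) else 0)"
        by (simp only: distrib_left if_distrib[of "\<lambda>c. x (Mc k a b) * c"] mult_zero_right mult_1_right
            mult.commute[of "eps k"] conj_commute[of "l = j"])
      then show ?thesis using True by (simp only: Mc eta.simps Edir.simps s if_True refl)
    next
      case False
      have "x (Mc k a b) = 0" "x (Mc k b a) = 0" by (rule W_out(1)[OF assms(1) False])+
      then show ?thesis using False by (simp only: Mc eta.simps if_False if_cancel add_0_left)
    qed
    finally show ?thesis by simp
  qed auto
qed

text \<open>Applying \<open>xi i a\<close> and then \<open>xi j b\<close> to the equation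
  \<open>f\<close> gives zero on \<open>X\<close>. By \<open>second_derivative\<close> this is a
  relation linear in the \<open>(a, b)\<close> entries, up to a remainder without entries having
  both indices large.\<close>

lemma matrix_relation:
  assumes X: "X \<subseteq> W P N M" "tv_stable 0 X" "\<forall>x\<in>X. f x = 0" and "finite P"
    and f: "f \<in> polys {u. low K u}" and ij: "i < K" "j < K" "K \<le> a" "K \<le> b"
  obtains R where "R \<in> polys {u. kept K {} UNIV u}"
    "\<And>x. x \<in> X \<Longrightarrow> (\<Sum>k\<in>P. x (Mc k a b) * D f x (Edir k i j)) + R x = 0"
proof
  let ?f = "\<lambda>y. D f y (xi i a y)"
  let ?R = "\<lambda>x. D ?f x (xi j b x) - D f x (eta i j a b x)"
  show "?R \<in> polys {u. kept K {} UNIV u}" by (rule second_derivative[OF f ij])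
  fix x assume x: "x \<in> X"
  have fU: "f \<in> polys UNIV" using f by (rule polys_UNIV)
  have "?f \<in> polys {u. kept K {} UNIV u}"
    by (rule polys_D[OF f]) (auto intro: low_kept polys_xi)
  then have f1: "?f \<in> polys UNIV" by (rule polys_UNIV)
  have "\<forall>x\<in>X. ?f x = 0" using D_xi_eq_0[OF fU X(2,3)] ij by auto
  then have "D ?f x (xi j b x) = 0" using D_xi_eq_0[OF f1 X(2) _ x] ij by auto
  moreover have "D f x (eta i j a b x) = (\<Sum>k\<in>P. x (Mc k a b) * D f x (Edir k i j))"
    using eta_W[of x P N M] X(1) x assms(4) D_sum[OF f assms(4)] by auto
  ultimately show "(\<Sum>k\<in>P. x (Mc k a b) * D f x (Edir k i j)) + ?R x = 0" by simp
qed

lemma elim_matrix: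
  assumes N: "\<And>N M. finite N \<Longrightarrow> finite M \<Longrightarrow> noeth 0 (W P N M)"
    and fin: "finite P" "finite N" "finite M" and k0: "k0 \<notin> P"
    and X: "X \<subseteq> W (insert k0 P) N M" "tv_stable 0 X" "\<forall>x\<in>X. f x = 0" and f: "f \<in> polys UNIV"
  shows "\<exists>K. tv_stable K {x\<in>X. D f x (Edir k0 i j) \<noteq> 0} \<and> noeth K {x\<in>X. D f x (Edir k0 i j) \<noteq> 0}"
proof -
  obtain K1 where K1: "f \<in> polys {u. low K1 u}" using polys_low[OF f] by blast
  \<comment> \<open>Large enough for \<open>f\<close> to involve only low coordinates and for
    \<open>i\<close> and \<open>j\<close> to be low.\<close>
  define K where "K = max K1 (Suc (max i j))"
  have K: "i < K" "j < K" unfolding K_def by auto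
  have fK: "f \<in> polys {u. low K u}"
    using K1 by (rule polys_mono) (auto simp: K_def intro: low_mono)
  have DK: "(\<lambda>x. D f x E) \<in> polys {u. low K u}" for E
    by (rule polys_D[OF fK]) (auto intro: polys.const)
  let ?h = "\<lambda>x. D f x (Edir k0 i j)"
  let ?Y = "{x\<in>X. ?h x \<noteq> 0}"
  have st: "tv_stable K ?Y" by (rule stable_open[OF X(2) DK])
  have YW: "?Y \<subseteq> W (insert k0 P) N M" using X(1) by blast
  have "noeth K ?Y"
  proof (rule noeth_elim[OF N st YW DK])
    show "finite (slice_vecs K (insert k0 P) N)" "finite (slice_scals K (insert k0 P) N M)"
      using fin by (auto intro: finite_slice)
    fix u assume u: "\<not> kept K P N u"
    show "\<exists>F\<in>polys {u. kept K P N u}. \<forall>y\<in>?Y. ?h y * y u = F y"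
    proof (cases "\<exists>a b. u = Mc k0 a b")
      case True
      then obtain a b where ab: "u = Mc k0 a b" "K \<le> a" "K \<le> b" using u by auto
      obtain R where R: "R \<in> polys {u. kept K {} UNIV u}"
        "\<And>x. x \<in> X \<Longrightarrow> (\<Sum>k\<in>insert k0 P. x (Mc k a b) * D f x (Edir k i j)) + R x = 0"
        using matrix_relation[OF X _ fK K ab(2,3)] fin by blast
      \<comment> \<open>\<open>R\<close> may mention vectors outside \<open>N\<close>. These are
        zero on \<open>X\<close>, and substituting zero for them leaves a polynomial in kept
        coordinates with the same values on \<open>X\<close>.\<close>
      define R' where "R' x = R (zero_on {u. \<exists>ks l. u = Vc ks l \<and> ks \<notin> N} x)" for x
      have R': "R' \<in> polys {u. kept K P N u}"
        unfolding R'_def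
      proof (rule polys_subst[OF R(1)])
        fix u assume "u \<in> {u. kept K {} UNIV u}"
        then show "(\<lambda>x. zero_on {u. \<exists>ks l. u = Vc ks l \<and> ks \<notin> N} x u) \<in> polys {u. kept K P N u}"
        proof (cases u)
          case (Vc ks l)
          then show ?thesis by (cases "ks \<in> N") (auto simp: zero_on_def intro: polys.intros)
        qed (auto simp: zero_on_def intro: polys.intros)
      qed
      have RR': "R' x = R x" if "x \<in> X" for x
      proof -
        have "zero_on {u. \<exists>ks l. u = Vc ks l \<and> ks \<notin> N} x = x"
          using W_out(2)[of x "insert k0 P" N M] X(1) that by (force simp: zero_on_def)
        then show ?thesis by (simp add: R'_def)
      qed
      \<comment> \<open>The relation solved for the term of the matrix \<open>k0\<close>, whose
        coefficient is \<open>?h\<close>.\<close>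
      let ?F = "\<lambda>x. - ((\<Sum>k\<in>P. x (Mc k a b) * D f x (Edir k i j)) + R' x)"
      have "?F \<in> polys {u. kept K P N u}"
      proof (intro polys_minus polys.add polys_sum polys.mult R')
        fix k assume "k \<in> P"
        then show "(\<lambda>x. x (Mc k a b)) \<in> polys {u. kept K P N u}" by (auto intro: polys.coord)
        show "(\<lambda>x. D f x (Edir k i j)) \<in> polys {u. kept K P N u}"
          using DK by (rule polys_mono) (auto intro: low_kept)
      qed
      moreover have "?h y * y u = ?F y" if "y \<in> ?Y" for y
      proof -
        have "y (Mc k0 a b) * ?h y + (\<Sum>k\<in>P. y (Mc k a b) * D f y (Edir k i j)) + R' y = 0"
          using R(2)[of y] RR'[of y] that k0 fin(1) by (simp add: add.assoc)
        then show ?thesis unfolding ab(1) by (simp add: add_eq_0_iff algebra_simps)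
      qed
      ultimately show ?thesis by (rule_tac bexI[of _ ?F]) simp_all
    next
      case False
      then have "y u = 0" if "y \<in> ?Y" for y
        using u W_out[of y "insert k0 P" N M] YW that by (cases u) auto
      then show ?thesis by (rule_tac bexI[of _ "\<lambda>x. 0"]) (simp_all add: polys.const)
    qed
  qed simp
  then show ?thesis using st by blast
qed

text \<open>The hypothesis covers all finite \<open>N\<close> and \<open>M\<close>, because slicing
  trades one matrix for more vectors and scalars.\<close>

lemma noeth_insert_matrix:
  assumes N: "\<And>N M. finite N \<Longrightarrow> finite M \<Longrightarrow> noeth 0 (W P N M)"
    and fin: "finite P" "finite N" "finite M" and k0: "k0 \<notin> P"
  shows "noeth 0 (W (insert k0 P) N M)"
proof -
  let ?F = "{u. \<exists>l m. u = Mc k0 l m}"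
  let ?dirs = "{Edir k0 i j |i j. True}"
  show ?thesis
  proof (rule noeth_fibration[OF N[OF fin(2,3)] stable_W, where F = ?F and dirs = ?dirs])
    fix x assume x: "x \<in> W (insert k0 P) N M"
    show "zero_on ?F x \<in> W P N M"
    proof (rule W_I)
      show "zero_on ?F x (Mc k j i) = eps k * zero_on ?F x (Mc k i j)" for k i j
        using W_sym[OF x, of k j i] by (simp add: zero_on_def)
      show "zero_on ?F x (Mc k i j) = 0" if "k \<notin> P" for k i j
        using W_out(1)[OF x, of k i j] that by (simp add: zero_on_def)
    qed (simp_all add: zero_on_def W_out[OF x])
    show "(\<lambda>c. if c \<in> ?F then t * x c else x c) \<in> W (insert k0 P) N M" for t
    proof (rule W_I)
      show "(if Mc k j i \<in> ?F then t * x (Mc k j i) else x (Mc k j i))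
        = eps k * (if Mc k i j \<in> ?F then t * x (Mc k i j) else x (Mc k i j))" for k i j
        using W_sym[OF x, of k j i] by (cases "k = k0") (simp_all add: mult.left_commute)
    qed (simp_all add: W_out[OF x])
  next
    fix i a t x
    show "tv i a t (zero_on ?F x) = zero_on ?F (tv i a t x)"
    proof
      fix u show "tv i a t (zero_on ?F x) u = zero_on ?F (tv i a t x) u"
        by (cases u) (auto simp: zero_on_def)
    qed
  next
    fix E c assume "E \<in> ?dirs" "c \<notin> ?F"
    then show "E c = 0" by (cases c) auto
  next
    fix f x y assume f: "f \<in> polys UNIV" and x: "x \<in> W (insert k0 P) N M"
      and D0: "\<forall>E\<in>?dirs. D f y E = 0"
    obtain K where fK: "f \<in> polys {u. low K u}" using polys_low[OF f] by blast
    let ?I = "{..<K} \<times> {..<K}"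
    \<comment> \<open>As \<open>f\<close> sees only indices below \<open>K\<close>, a finite sum
      suffices. The factor 1/2 corrects for each entry being reached from both \<open>(l, m)\<close>
      and \<open>(m, l)\<close>, or twice on the diagonal.\<close>
    have "D f y (\<lambda>c. if c \<in> ?F then x c else 0)
      = D f y (\<lambda>u. \<Sum>p\<in>?I. (x (Mc k0 (fst p) (snd p)) / 2) * Edir k0 (fst p) (snd p) u)"
    proof (rule D_cong[OF fK])
      fix u assume u: "u \<in> {u. low K u}"
      show "(if u \<in> ?F then x u else 0)
        = (\<Sum>p\<in>?I. (x (Mc k0 (fst p) (snd p)) / 2) * Edir k0 (fst p) (snd p) u)"
      proof (cases "u \<in> ?F")
        case True
        then obtain l m where lm: "u = Mc k0 l m" "l < K" "m < K" using u by auto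
        have "(\<Sum>p\<in>?I. (x (Mc k0 (fst p) (snd p)) / 2) * Edir k0 (fst p) (snd p) u)
          = (\<Sum>p\<in>?I. (if p = (l, m) then x (Mc k0 l m) / 2 else 0)
              + (if p = (m, l) then x (Mc k0 m l) / 2 * eps k0 else 0))"
        proof (rule sum.cong[OF refl])
          fix p :: "nat \<times> nat"
          obtain i j where p: "p = (i, j)" by (cases p)
          have 1: "x (Mc k0 i j) / 2 * (if l = i \<and> m = j then 1 else 0)
              = (if (i, j) = (l, m) then x (Mc k0 l m) / 2 else 0)"
            by (cases "(i, j) = (l, m)") auto
          have 2: "x (Mc k0 i j) / 2 * (if l = j \<and> m = i then eps k0 else 0)
              = (if (i, j) = (m, l) then x (Mc k0 m l) / 2 * eps k0 else 0)"
            by (cases "(i, j) = (m, l)") auto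
          show "x (Mc k0 (fst p) (snd p)) / 2 * Edir k0 (fst p) (snd p) u
            = (if p = (l, m) then x (Mc k0 l m) / 2 else 0)
              + (if p = (m, l) then x (Mc k0 m l) / 2 * eps k0 else 0)"
            unfolding p lm(1) Edir.simps fst_conv snd_conv 1[symmetric] 2[symmetric]
            by (simp only: distrib_left refl if_True)
        qed
        also have "\<dots> = x (Mc k0 l m) / 2 + x (Mc k0 m l) / 2 * eps k0"
          using lm by (simp add: sum.distrib)
        also have "\<dots> = x u" using W_sym[OF x, of k0 m l] lm by (simp add: eps_def)
        finally show ?thesis using True by simp
      next
        case False
        then show ?thesis by (cases u) auto
      qed
    qed
    also have "\<dots> = (\<Sum>p\<in>?I. (x (Mc k0 (fst p) (snd p)) / 2) * D f y (Edir k0 (fst p) (snd p)))"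
      by (rule D_sum[OF fK]) simp
    also have "\<dots> = 0" using D0 by (intro sum.neutral) auto
    finally show "D f y (\<lambda>c. if c \<in> ?F then x c else 0) = 0" .
  next
    fix X f E assume X: "X \<subseteq> W (insert k0 P) N M" "tv_stable 0 X" and f: "f \<in> polys UNIV"
      and f0: "\<forall>x\<in>X. f x = 0" and "E \<in> ?dirs"
    then obtain i j where "E = Edir k0 i j" by blast
    then show "\<exists>K. tv_stable K {x\<in>X. D f x E \<noteq> 0} \<and> noeth K {x\<in>X. D f x E \<noteq> 0}"
      using elim_matrix[OF N fin k0 X f0 f] by blast
  qed
qed

section \<open>Eliminating a vector\<close>

fun Vdir :: "nat list \<Rightarrow> nat \<Rightarrow> wpt" where
  "Vdir ks i (Mc _ _ _) = 0"
| "Vdir ks i (Vc ks' l) = (if ks' = ks \<and> l = i then 1 else 0)"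
| "Vdir ks i (Sc _) = 0"

text \<open>Without matrices a single derivation already moves in the directions \<open>Vdir\<close>
  only, with the large entries as coefficients; this is why one transvection suffices for
  vectors.\<close>

lemma xi_W:
  assumes "x \<in> W {} N M" "finite N"
  shows "xi i a x = (\<lambda>u. \<Sum>ks\<in>N. x (Vc ks a) * Vdir ks i u)"
proof
  fix u
  show "xi i a x u = (\<Sum>ks\<in>N. x (Vc ks a) * Vdir ks i u)"
  proof (cases u)
    case (Mc k l m)
    then show ?thesis by (simp add: W_out(1)[OF assms(1)])
  next
    case (Vc ks l)
    have "(\<Sum>ks'\<in>N. x (Vc ks' a) * Vdir ks' i u)
      = (\<Sum>ks'\<in>N. if ks' = ks then (if l = i then x (Vc ks a) else 0) else 0)"
      by (rule sum.cong) (auto simp: Vc)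
    also have "\<dots> = (if ks \<in> N then (if l = i then x (Vc ks a) else 0) else 0)"
      using assms(2) by (simp add: sum.delta)
    also have "\<dots> = xi i a x u"
      using W_out(2)[OF assms(1), of ks a] by (simp add: Vc)
    finally show ?thesis by simp
  next
    case (Sc ks)
    then show ?thesis by simp
  qed
qed

text \<open>With no matrices slicing creates no new vectors, but it renames the old ones; hence the
  hypothesis speaks of the number of vectors.\<close>

lemma elim_vector:
  assumes N: "\<And>N' M. finite N' \<Longrightarrow> card N' = card N \<Longrightarrow> finite M \<Longrightarrow> noeth 0 (W {} N' M)"
    and fin: "finite N" "finite M" and k0: "k0 \<notin> N"
    and X: "X \<subseteq> W {} (insert k0 N) M" "tv_stable 0 X" "\<forall>x\<in>X. f x = 0" and f: "f \<in> polys UNIV"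
  shows "\<exists>K. tv_stable K {x\<in>X. D f x (Vdir k0 i) \<noteq> 0} \<and> noeth K {x\<in>X. D f x (Vdir k0 i) \<noteq> 0}"
proof -
  obtain K1 where K1: "f \<in> polys {u. low K1 u}" using polys_low[OF f] by blast
  define K where "K = max K1 (Suc i)"
  have K: "i < K" unfolding K_def by auto
  have fK: "f \<in> polys {u. low K u}"
    using K1 by (rule polys_mono) (auto simp: K_def intro: low_mono)
  have DK: "(\<lambda>x. D f x E) \<in> polys {u. low K u}" for E
    by (rule polys_D[OF fK]) (auto intro: polys.const)
  let ?h = "\<lambda>x. D f x (Vdir k0 i)"
  let ?Y = "{x\<in>X. ?h x \<noteq> 0}"
  have st: "tv_stable K ?Y" by (rule stable_open[OF X(2) DK])
  have YW: "?Y \<subseteq> W {} (insert k0 N) M" using X(1) by blast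
  have "noeth K ?Y"
  proof (rule noeth_elim[OF N st YW DK])
    have "slice_vecs K {} N = (#) 0 ` N" unfolding slice_vecs_def by simp
    then show "card (slice_vecs K {} N) = card N" by (simp add: card_image)
    show "finite (slice_vecs K {} N)" "finite (slice_scals K {} (insert k0 N) M)"
      using fin by (auto intro: finite_slice)
    fix u assume u: "\<not> kept K {} N u"
    show "\<exists>F\<in>polys {u. kept K {} N u}. \<forall>y\<in>?Y. ?h y * y u = F y"
    proof (cases "\<exists>a. u = Vc k0 a")
      case True
      then obtain a where a: "u = Vc k0 a" "K \<le> a" using u by auto
      let ?F = "\<lambda>x. - (\<Sum>ks\<in>N. x (Vc ks a) * D f x (Vdir ks i))"
      have "?F \<in> polys {u. kept K {} N u}"
      proof (intro polys_minus polys_sum polys.mult)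
        fix ks assume "ks \<in> N"
        then show "(\<lambda>x. x (Vc ks a)) \<in> polys {u. kept K {} N u}" by (auto intro: polys.coord)
        show "(\<lambda>x. D f x (Vdir ks i)) \<in> polys {u. kept K {} N u}"
          using DK by (rule polys_mono) (auto intro: low_kept)
      qed
      moreover have "?h y * y u = ?F y" if "y \<in> ?Y" for y
      proof -
        have y: "y \<in> X" "y \<in> W {} (insert k0 N) M" using that X(1) by auto
        have fin': "finite (insert k0 N)" using fin by simp
        have "0 = D f y (xi i a y)" using D_xi_eq_0[OF f X(2,3) y(1), of i a] K a(2) by simp
        also have "\<dots> = (\<Sum>ks\<in>insert k0 N. y (Vc ks a) * D f y (Vdir ks i))"
          unfolding xi_W[OF y(2) fin'] by (rule D_sum[OF f fin'])
        also have "\<dots> = y (Vc k0 a) * ?h y + (\<Sum>ks\<in>N. y (Vc ks a) * D f y (Vdir ks i))"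
          using fin k0 by simp
        finally show ?thesis unfolding a(1) by (simp add: eq_neg_iff_add_eq_0 mult.commute)
      qed
      ultimately show ?thesis by (rule_tac bexI[of _ ?F]) simp_all
    next
      case False
      then have "y u = 0" if "y \<in> ?Y" for y
        using u W_out[of y "{}" "insert k0 N" M] YW that by (cases u) auto
      then show ?thesis by (rule_tac bexI[of _ "\<lambda>x. 0"]) (simp_all add: polys.const)
    qed
  qed simp_all
  then show ?thesis using st by blast
qed

lemma noeth_insert_vector:
  assumes N: "\<And>N' M. finite N' \<Longrightarrow> card N' = card N \<Longrightarrow> finite M \<Longrightarrow> noeth 0 (W {} N' M)"
    and fin: "finite N" "finite M" and k0: "k0 \<notin> N"
  shows "noeth 0 (W {} (insert k0 N) M)"
proof -
  let ?F = "{u. \<exists>l. u = Vc k0 l}"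
  let ?dirs = "{Vdir k0 i |i. True}"
  show ?thesis
  proof (rule noeth_fibration[OF N[OF fin(1) refl fin(2)] stable_W, where F = ?F and dirs = ?dirs])
    fix x assume x: "x \<in> W {} (insert k0 N) M"
    show "zero_on ?F x \<in> W {} N M"
    proof (rule W_I)
      show "zero_on ?F x (Vc ks i) = 0" if "ks \<notin> N" for ks i
        using W_out(2)[OF x, of ks i] that by (simp add: zero_on_def)
    qed (simp_all add: zero_on_def W_out[OF x])
    show "(\<lambda>c. if c \<in> ?F then t * x c else x c) \<in> W {} (insert k0 N) M" for t
      by (rule W_I) (simp_all add: W_out[OF x])
  next
    fix i a t x
    show "tv i a t (zero_on ?F x) = zero_on ?F (tv i a t x)"
    proof
      fix u show "tv i a t (zero_on ?F x) u = zero_on ?F (tv i a t x) u"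
        by (cases u) (auto simp: zero_on_def)
    qed
  next
    fix E c assume "E \<in> ?dirs" "c \<notin> ?F"
    then show "E c = 0" by (cases c) auto
  next
    fix f x y assume f: "f \<in> polys UNIV" and x: "x \<in> W {} (insert k0 N) M"
      and D0: "\<forall>E\<in>?dirs. D f y E = 0"
    obtain K where fK: "f \<in> polys {u. low K u}" using polys_low[OF f] by blast
    have "D f y (\<lambda>c. if c \<in> ?F then x c else 0) = D f y (\<lambda>u. \<Sum>i<K. x (Vc k0 i) * Vdir k0 i u)"
    proof (rule D_cong[OF fK])
      fix u assume u: "u \<in> {u. low K u}"
      show "(if u \<in> ?F then x u else 0) = (\<Sum>i<K. x (Vc k0 i) * Vdir k0 i u)"
      proof (cases "u \<in> ?F")
        case True
        then obtain l where l: "u = Vc k0 l" "l < K" using u by auto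
        have "(\<Sum>i<K. x (Vc k0 i) * Vdir k0 i u) = (\<Sum>i<K. if i = l then x (Vc k0 l) else 0)"
          by (rule sum.cong) (auto simp: l)
        also have "\<dots> = x u" using l by simp
        finally show ?thesis using True by simp
      next
        case False
        then show ?thesis by (cases u) auto
      qed
    qed
    also have "\<dots> = (\<Sum>i<K. x (Vc k0 i) * D f y (Vdir k0 i))"
      by (rule D_sum[OF fK]) simp
    also have "\<dots> = 0" using D0 by (intro sum.neutral) auto
    finally show "D f y (\<lambda>c. if c \<in> ?F then x c else 0) = 0" .
  next
    fix X f E assume X: "X \<subseteq> W {} (insert k0 N) M" "tv_stable 0 X" and f: "f \<in> polys UNIV"
      and f0: "\<forall>x\<in>X. f x = 0" and "E \<in> ?dirs"
    then obtain i where "E = Vdir k0 i" by blast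
    then show "\<exists>K. tv_stable K {x\<in>X. D f x E \<noteq> 0} \<and> noeth K {x\<in>X. D f x E \<noteq> 0}"
      using elim_vector[OF N fin k0 X f0 f] by blast
  qed
qed

section \<open>Adjoining a scalar\<close>

text \<open>Polynomials in \<open>s\<close> over those free of \<open>s\<close>, with the top
  coefficient visible for division. The bound is strict so that the zero polynomial gets degree
  bound 0.\<close>

inductive deg_lt :: "co \<Rightarrow> nat \<Rightarrow> (wpt \<Rightarrow> complex) \<Rightarrow> bool" for s where
  zero: "deg_lt s 0 (\<lambda>x. 0)"
| step: "deg_lt s d g \<Longrightarrow> a \<in> polys {u. u \<noteq> s} \<Longrightarrow> deg_lt s (Suc d) (\<lambda>x. g x + a x * x s ^ d)"

lemma deg_lt_mono: assumes "deg_lt s d f" "d \<le> e" shows "deg_lt s e f"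
  using assms(2,1)
proof (induction rule: dec_induct)
  case (step e)
  then show ?case using deg_lt.step[of s e f "\<lambda>x. 0"] by (simp add: polys.const)
qed

lemma deg_lt_add: "deg_lt s d f \<Longrightarrow> deg_lt s d g \<Longrightarrow> deg_lt s d (\<lambda>x. f x + g x)"
proof (induction arbitrary: g rule: deg_lt.induct)
  case zero
  then show ?case by simp
next
  case (step d f a)
  from step.prems obtain g' b where g: "g = (\<lambda>x. g' x + b x * x s ^ d)" "deg_lt s d g'"
    "b \<in> polys {u. u \<noteq> s}" by (cases rule: deg_lt.cases) auto
  have "deg_lt s (Suc d) (\<lambda>x. (f x + g' x) + (a x + b x) * x s ^ d)"
    by (intro deg_lt.step step.IH g polys.add step.hyps)
  then show ?case unfolding g(1) by (simp add: algebra_simps)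
qed

lemma deg_lt_scale:
  assumes "a \<in> polys {u. u \<noteq> s}" "deg_lt s d f" shows "deg_lt s d (\<lambda>x. a x * f x)"
  using assms(2)
proof (induction rule: deg_lt.induct)
  case zero
  then show ?case by (simp add: deg_lt.zero)
next
  case (step d f b)
  have "deg_lt s (Suc d) (\<lambda>x. a x * f x + (a x * b x) * x s ^ d)"
    by (intro deg_lt.step step.IH polys.mult assms(1) step.hyps)
  then show ?case by (simp add: algebra_simps)
qed

lemma deg_lt_shift: "deg_lt s d f \<Longrightarrow> deg_lt s (Suc d) (\<lambda>x. x s * f x)"
proof (induction rule: deg_lt.induct)
  case zero
  then show ?case using deg_lt_mono[OF deg_lt.zero, of 1] by simp
next
  case (step d f b)
  have "deg_lt s (Suc (Suc d)) (\<lambda>x. x s * f x + b x * x s ^ Suc d)"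
    by (intro deg_lt.step step.IH step.hyps)
  then show ?case by (simp add: algebra_simps)
qed

lemma deg_lt_shift_power: "deg_lt s d f \<Longrightarrow> deg_lt s (n + d) (\<lambda>x. x s ^ n * f x)"
proof (induction n)
  case (Suc n)
  show ?case using deg_lt_shift[OF Suc.IH[OF Suc.prems]] by (simp add: mult.assoc)
qed simp

lemma deg_lt_mult:
  assumes "deg_lt s d f" "deg_lt s e g" shows "deg_lt s (e + d) (\<lambda>x. f x * g x)"
  using assms(2)
proof (induction rule: deg_lt.induct)
  case zero
  then show ?case using deg_lt_mono[OF deg_lt.zero] by simp
next
  case (step e g a)
  have "deg_lt s (e + d) (\<lambda>x. f x * g x + x s ^ e * (a x * f x))"
    by (intro deg_lt_add step.IH deg_lt_shift_power deg_lt_scale step.hyps assms(1))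
  then have "deg_lt s (Suc e + d) (\<lambda>x. f x * g x + x s ^ e * (a x * f x))"
    by (rule deg_lt_mono) simp
  then show ?case by (simp add: algebra_simps)
qed

lemma deg_lt_base: "a \<in> polys {u. u \<noteq> s} \<Longrightarrow> deg_lt s 1 a"
  using deg_lt.step[OF deg_lt.zero, of a s] by simp

lemma polys_deg_lt: "f \<in> polys U \<Longrightarrow> \<exists>d. deg_lt s d f"
proof (induction rule: polys.induct)
  case (const a)
  show ?case using deg_lt_base[OF polys.const] by blast
next
  case (coord u)
  show ?case
  proof (cases "u = s")
    case True
    have "deg_lt s (Suc 1) (\<lambda>x. x s * 1)" by (intro deg_lt_shift deg_lt_base polys.const)
    then show ?thesis using True by auto
  next
    case False
    have "deg_lt s 1 (\<lambda>x. x u)" by (rule deg_lt_base, rule polys.coord) (simp add: False)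
    then show ?thesis by blast
  qed
next
  case (add f g)
  then obtain d e where "deg_lt s d f" "deg_lt s e g" by blast
  then have "deg_lt s (max d e) f" "deg_lt s (max d e) g" by (auto intro: deg_lt_mono)
  then show ?case using deg_lt_add by blast
next
  case (mult f g)
  then show ?case using deg_lt_mult by blast
qed

text \<open>Multiplying \<open>p\<close> by the leading coefficient \<open>a\<close> of
  \<open>f\<close> lets a multiple of \<open>f\<close> cancel the top term of \<open>p\<close>.
  Repeating this lowers the degree in \<open>s\<close> until it is below that of
  \<open>f\<close>.\<close>

lemma pseudo_division:
  assumes f: "f = (\<lambda>x. g x + a x * x s ^ d)" "deg_lt s d g" "a \<in> polys {u. u \<noteq> s}"
    and "deg_lt s e p"
  shows "\<exists>n q r. deg_lt s d r \<and> (\<forall>x. a x ^ n * p x = q x * f x + r x)"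
  using assms(4)
proof (induction e arbitrary: p)
  case 0
  then have "deg_lt s d p" by (rule deg_lt_mono) simp
  then show ?case by (intro exI[of _ "0::nat"] exI[of _ "\<lambda>x. 0"] exI[of _ p]) simp
next
  case (Suc e)
  show ?case
  proof (cases "Suc e \<le> d")
    case True
    with Suc.prems have "deg_lt s d p" by (rule deg_lt_mono)
    then show ?thesis by (intro exI[of _ "0::nat"] exI[of _ "\<lambda>x. 0"] exI[of _ p]) simp
  next
    case False
    from Suc.prems obtain p' b where p: "p = (\<lambda>x. p' x + b x * x s ^ e)" "deg_lt s e p'"
      "b \<in> polys {u. u \<noteq> s}" by (cases rule: deg_lt.cases) auto
    define k where "k = e - d"
    have e: "e = k + d" using False unfolding k_def by simp
    have mb: "(\<lambda>x. - b x) \<in> polys {u. u \<noteq> s}" using p(3) by (rule polys_minus)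
    have "deg_lt s e (\<lambda>x. a x * p' x + x s ^ k * (- b x * g x))"
      unfolding e
      by (rule deg_lt_add[OF deg_lt_scale[OF f(3) p(2)[unfolded e]] deg_lt_shift_power[OF deg_lt_scale[OF mb f(2)]]])
    moreover have "(\<lambda>x. a x * p' x + x s ^ k * (- b x * g x)) = (\<lambda>x. a x * p x - b x * x s ^ k * f x)"
      by (simp add: f(1) p(1) e power_add algebra_simps)
    ultimately have "deg_lt s e (\<lambda>x. a x * p x - b x * x s ^ k * f x)" by simp
    from Suc.IH[OF this] obtain n q r where r: "deg_lt s d r"
      "\<And>x. a x ^ n * (a x * p x - b x * x s ^ k * f x) = q x * f x + r x" by blast
    have "a x ^ Suc n * p x = (q x + a x ^ n * b x * x s ^ k) * f x + r x" for x
      using r(2)[of x] by (simp add: algebra_simps)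
    then show ?thesis using r(1)
      by (intro exI[of _ "Suc n"] exI[of _ "\<lambda>x. q x + a x ^ n * b x * x s ^ k"] exI[of _ r]) simp
  qed
qed

lemma stable_scalars: assumes "X \<subseteq> W {} {} M" shows "tv_stable K X"
proof -
  have "tv i a t x = x" if "x \<in> X" for i a t x
  proof
    have x: "x \<in> W {} {} M" using that assms by blast
    fix u show "tv i a t x u = x u" by (cases u) (simp_all add: W_out[OF x])
  qed
  then show ?thesis unfolding tv_stable_def by simp
qed

text \<open>A relative Hilbert basis argument over \<open>B'\<close>, with an equation
  \<open>f\<close> of least degree in \<open>s\<close>. Where its leading coefficient vanishes, a
  smaller base takes over; elsewhere \<open>f\<close> decides membership in all late members of the
  chain.\<close>

lemma noeth_insert_scalar:
  assumes N: "noeth 0 (W {} {} M)"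
  shows "noeth 0 (W {} {} (insert k0 M))"
proof -
  define s where "s = Sc k0"
  define R where "R B = {x \<in> W {} {} (insert k0 M). zero_on {s} x \<in> B}" for B
  have Rst: "tv_stable 0 (R B)" for B
    by (rule stable_scalars[of _ "insert k0 M"]) (auto simp: R_def)
  have "noeth 0 (R (W {} {} M))"
  proof (rule noeth_induct[OF N _ closed_in_refl stable_W])
    fix B' assume B': "closed_in (W {} {} M) B'" "tv_stable 0 B'"
    assume IH: "\<And>B''. closed_in (W {} {} M) B'' \<Longrightarrow> tv_stable 0 B'' \<Longrightarrow> B'' \<subset> B' \<Longrightarrow> noeth 0 (R B'')"
    show "noeth 0 (R B')"
      unfolding noeth_def
    proof (intro allI impI)
      fix Z assume "\<forall>n. closed_in (R B') (Z n) \<and> tv_stable 0 (Z n) \<and> Z (Suc n) \<subseteq> Z (n::nat)"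
      then have cl: "closed_in (R B') (Z n)" and st: "tv_stable 0 (Z n)" and de: "Z (Suc n) \<subseteq> Z n" for n
        by simp_all
      have ZR: "Z n \<subseteq> R B'" for n using cl by (rule closed_in_sub)
      define A where "A d n f \<longleftrightarrow> deg_lt s d f \<and> (\<forall>z\<in>Z n. f z = 0) \<and> (\<exists>x\<in>R B'. f x \<noteq> 0)" for d n f
      show "\<exists>n C. \<forall>m\<ge>n. Z m = C"
      proof (cases "\<forall>n. Z n = R B'")
        case True
        then show ?thesis by (intro exI[of _ 0] exI[of _ "R B'"]) simp
      next
        case False
        then obtain n0 x0 where x0: "x0 \<in> R B'" "x0 \<notin> Z n0" using ZR by blast
        obtain p0 where p0: "p0 \<in> polys UNIV" "p0 x0 \<noteq> 0" "\<And>z. z \<in> Z n0 \<Longrightarrow> p0 z = 0"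
          using closed_inD[OF cl x0] by blast
        obtain e0 where "deg_lt s e0 p0" using polys_deg_lt[OF p0(1)] by blast
        then have ex: "\<exists>d n f. A d n f" using p0 x0 unfolding A_def by blast
        \<comment> \<open>The minimum runs over all members of the chain together, so it also
          governs equations of later members.\<close>
        define d where "d = (LEAST d. \<exists>n f. A d n f)"
        have "\<exists>n f. A d n f" unfolding d_def by (rule LeastI_ex[OF ex])
        then obtain n f where nf: "A d n f" by blast
        have min: "\<not> A d' n f" if "d' < d" for d' n f
          using not_less_Least[OF that[unfolded d_def]] by blast
        have f: "deg_lt s d f" "\<And>z. z \<in> Z n \<Longrightarrow> f z = 0" "\<exists>x\<in>R B'. f x \<noteq> 0"
          using nf unfolding A_def by blast+
        from f(1) f(3) obtain d' g a where d': "d = Suc d'" "f = (\<lambda>x. g x + a x * x s ^ d')"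
          "deg_lt s d' g" "a \<in> polys {u. u \<noteq> s}" by (cases rule: deg_lt.cases) auto
        have low0: "r x = 0" if "deg_lt s d' r" "\<And>z. z \<in> Z m \<Longrightarrow> r z = 0" "x \<in> R B'" for r m x
          using min[of d' m r] d'(1) that unfolding A_def by blast
        \<comment> \<open>Otherwise \<open>f\<close> agrees over \<open>B'\<close> with its lower
          part \<open>g\<close>, against minimality.\<close>
        have "\<exists>x\<in>R B'. a x \<noteq> 0"
        proof (rule ccontr)
          assume "\<not> ?thesis"
          then have a0: "f x = g x" if "x \<in> R B'" for x using that by (simp add: d'(2))
          have "g x = 0" if "x \<in> R B'" for x
            using low0[OF d'(3), of n x] that f(2) a0 ZR[of n] by (metis subsetD)
          then show False using a0 f(3) by metis
        qed
        then obtain x1 where x1: "x1 \<in> R B'" "a x1 \<noteq> 0" by blast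
        \<comment> \<open>The coefficient \<open>a\<close> is free of \<open>s\<close>, hence a
          function on the base.\<close>
        have az: "a (zero_on {s} x) = a x" for x
          by (rule polys_cong[OF d'(4)]) (simp add: zero_on_def)
        define B'' where "B'' = {b\<in>B'. \<forall>f\<in>{a}. f b = 0}"
        have "closed_in B' B''" unfolding B''_def
          by (rule closed_in_zeros) (use d'(4) polys_UNIV in blast)
        then have clB: "closed_in (W {} {} M) B''" by (rule closed_in_trans[OF B'(1)])
        then have "tv_stable 0 B''" by (intro stable_scalars closed_in_sub)
        moreover have "B'' \<subset> B'"
        proof -
          have "zero_on {s} x1 \<in> B'" "zero_on {s} x1 \<notin> B''" using x1 az[of x1] by (simp_all add: R_def B''_def)
          then show ?thesis unfolding B''_def by blast
        qed
        ultimately have N'': "noeth 0 (R B'')" by (rule IH[OF clB])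
        have RR: "R B'' \<subseteq> R B'" unfolding R_def B''_def by blast
        have "\<exists>n1 C1. \<forall>m\<ge>n1. Z m \<inter> R B'' = C1"
        proof (rule noethD[OF N''])
          fix n
          show "closed_in (R B'') (Z n \<inter> R B'')" by (rule closed_in_Int[OF cl RR])
          show "tv_stable 0 (Z n \<inter> R B'')" by (rule stable_Int[OF st Rst])
          show "Z (Suc n) \<inter> R B'' \<subseteq> Z n \<inter> R B''" using de[of n] by blast
        qed
        then obtain n1 C1 where n1: "\<And>m. m \<ge> n1 \<Longrightarrow> Z m \<inter> R B'' = C1" by blast
        have "Z m = Z (max n n1)" if m: "m \<ge> max n n1" for m
        proof
          show "Z m \<subseteq> Z (max n n1)" by (rule chain_le[of Z, OF de m])
          show "Z (max n n1) \<subseteq> Z m"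
          proof
            fix x assume x: "x \<in> Z (max n n1)"
            have xR: "x \<in> R B'" using x ZR by blast
            show "x \<in> Z m"
            proof (cases "a x = 0")
              case True
              then have "x \<in> R B''" using xR az[of x] unfolding R_def B''_def by simp
              moreover have "Z m \<inter> R B'' = Z (max n n1) \<inter> R B''"
                using n1[of m] n1[of "max n n1"] m by simp
              ultimately show ?thesis using x by blast
            next
              case False
              show ?thesis
              proof (rule ccontr)
                assume xm: "x \<notin> Z m"
                obtain p where p: "p \<in> polys UNIV" "p x \<noteq> 0" "\<And>z. z \<in> Z m \<Longrightarrow> p z = 0"
                  using closed_inD[OF cl xR xm] by blast
                obtain e where "deg_lt s e p" using polys_deg_lt[OF p(1)] by blast
                \<comment> \<open>The remainder \<open>r\<close> vanishes on \<open>Z m\<close>, so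
                  by minimality on all of \<open>R B'\<close>. At \<open>x\<close> also
                  \<open>f\<close> vanishes, which forces \<open>p x = 0\<close>.\<close>
                then obtain k q r where r: "deg_lt s d' r" "\<And>x. a x ^ k * p x = q x * f x + r x"
                  using pseudo_division[OF d'(2-4)] by blast
                have Zn: "Z j \<subseteq> Z n" if "j \<ge> n" for j by (rule chain_le[of Z, OF de that])
                have "r z = 0" if "z \<in> Z m" for z
                proof -
                  have "f z = 0" using f(2) Zn[of m] m that by auto
                  then show ?thesis using r(2)[of z] p(3)[OF that] by simp
                qed
                then have "r x = 0" using low0[OF r(1) _ xR] by blast
                moreover have "f x = 0" using f(2) Zn[of "max n n1"] x by auto
                ultimately have "a x ^ k * p x = 0" using r(2)[of x] by simp
                then show False using False p(2) by simp
              qed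
            qed
          qed
        qed
        then have "\<forall>m\<ge>max n n1. Z m = Z (max n n1)" by blast
        then have "\<exists>C. \<forall>m\<ge>max n n1. Z m = C" ..
        then show ?thesis ..
      qed
    qed
  qed
  moreover have "R (W {} {} M) = W {} {} (insert k0 M)"
  proof -
    have "zero_on {s} x \<in> W {} {} M" if x: "x \<in> W {} {} (insert k0 M)" for x
    proof (rule W_I)
      show "zero_on {s} x (Sc ks) = 0" if "ks \<notin> M" for ks
        using W_out(3)[OF x, of ks] that by (auto simp: zero_on_def s_def)
    qed (simp_all add: zero_on_def W_out[OF x])
    then show ?thesis unfolding R_def by blast
  qed
  ultimately show ?thesis by simp
qed

section \<open>The Noetherianity theorem\<close>

lemma noeth_scalars:
  assumes "finite M" shows "noeth 0 (W {} {} M)"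
  using assms
proof (induction rule: finite_induct)
  case empty
  have W0: "x = (\<lambda>u. 0)" if x: "x \<in> W {} {} {}" for x
  proof
    fix u show "x u = 0" by (cases u) (simp_all add: W_out[OF x])
  qed
  show ?case
  proof (rule noeth_if_proper)
    fix X assume X: "closed_in (W {} {} {}) X" "X \<noteq> W {} {} {}"
    have "X = {}" using W0 closed_in_sub[OF X(1)] X(2) by blast
    then have "Z n = {}" if "closed_in X (Z n)" for Z and n :: nat
      using closed_in_sub[OF that] by blast
    then show "noeth 0 X" unfolding noeth_def by blast
  qed
next
  case (insert k M)
  then show ?case by (intro noeth_insert_scalar)
qed

text \<open>Induction on the number of vectors, with their names arbitrary, as slicing changes the
  names.\<close>

lemma noeth_vectors:
  assumes "finite N" "finite M" shows "noeth 0 (W {} N M)"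
  using assms
proof (induction "card N" arbitrary: N M)
  case 0
  then have "N = {}" by simp
  then show ?case using noeth_scalars[OF 0(3)] by simp
next
  case (Suc n)
  then obtain k N' where N: "N = insert k N'" "k \<notin> N'" "card N' = n"
    by (metis card_Suc_eq)
  have fin: "finite N'" using Suc.prems(1) N(1) by simp
  show ?case unfolding N(1)
  proof (rule noeth_insert_vector[OF _ fin Suc.prems(2) N(2)])
    fix N'' M :: "nat list set" assume "finite N''" "card N'' = card N'" "finite M"
    then show "noeth 0 (W {} N'' M)" using Suc.hyps(1)[of N'' M] N(3) by simp
  qed
qed

text \<open>\<open>N\<close> and \<open>M\<close> stay arbitrary in the induction, since removing a
  matrix enlarges both.\<close>

lemma noeth_W:
  assumes "finite P" "finite N" "finite M" shows "noeth 0 (W P N M)"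
  using assms
proof (induction arbitrary: N M rule: finite_induct)
  case empty
  then show ?case by (rule noeth_vectors)
next
  case (insert k P)
  show ?case
    by (rule noeth_insert_matrix[OF insert.IH insert.hyps(1) insert.prems insert.hyps(2)])
qed

section \<open>Comparison of the given spaces and group with the ambient spaces and
  transvections\<close>

fun emb :: "pt \<Rightarrow> wpt" where
  "emb (S, A, v, c) (Mc k i j) = (if even k then S (k div 2) i j else A (k div 2) i j)"
| "emb (S, A, v, c) (Vc ks i) = (case ks of [k] \<Rightarrow> v k i | _ \<Rightarrow> 0)"
| "emb (S, A, v, c) (Sc ks) = (case ks of [k] \<Rightarrow> c k | _ \<Rightarrow> 0)"

lemma emb_in_W:
  assumes "x \<in> Tspace p q n m"
  shows "emb x \<in> W ((\<lambda>k. 2 * k) ` {..<p} \<union> (\<lambda>k. 2 * k + 1) ` {..<q})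
    ((\<lambda>k. [k]) ` {..<n}) ((\<lambda>k. [k]) ` {..<m})"
proof -
  obtain S A v c where x: "x = (S, A, v, c)" by (cases x)
  have T: "(\<forall>k<p. \<forall>i j. S k i j = S k j i) \<and> (\<forall>k\<ge>p. S k = (\<lambda>i j. 0)) \<and>
     (\<forall>k<q. \<forall>i j. A k i j = - A k j i) \<and> (\<forall>k\<ge>q. A k = (\<lambda>i j. 0)) \<and>
     (\<forall>k\<ge>n. v k = (\<lambda>i. 0)) \<and> (\<forall>k\<ge>m. c k = 0)"
    using assms unfolding Tspace_def x by (simp only: mem_Collect_eq prod.case)
  have S: "k < p \<Longrightarrow> S k i j = S k j i" and A: "k < q \<Longrightarrow> A k i j = - A k j i" for k i j
    using T by blast+
  have "\<forall>k\<ge>p. S k = (\<lambda>i j. 0)" "\<forall>k\<ge>q. A k = (\<lambda>i j. 0)" "\<forall>k\<ge>n. v k = (\<lambda>i. 0)" "\<forall>k\<ge>m. c k = 0"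
    using T by - (elim conjE, assumption)+
  then have out: "\<not> k < p \<Longrightarrow> S k = (\<lambda>i j. 0)" "\<not> k < q \<Longrightarrow> A k = (\<lambda>i j. 0)"
    "\<not> k < n \<Longrightarrow> v k = (\<lambda>i. 0)" "\<not> k < m \<Longrightarrow> c k = 0" for k
    by simp_all
  show ?thesis
    unfolding x
  proof (rule W_I)
    fix k i j
    show "emb (S, A, v, c) (Mc k j i) = eps k * emb (S, A, v, c) (Mc k i j)"
    proof (cases "even k")
      case True
      then show ?thesis using S[of "k div 2" j i] out(1)[of "k div 2"]
        by (cases "k div 2 < p") (simp_all add: eps_def)
    next
      case False
      then show ?thesis using A[of "k div 2" j i] out(2)[of "k div 2"]
        by (cases "k div 2 < q") (simp_all add: eps_def)
    qed
  next
    fix k i j assume k: "k \<notin> (\<lambda>k. 2 * k) ` {..<p} \<union> (\<lambda>k. 2 * k + 1) ` {..<q}"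
    show "emb (S, A, v, c) (Mc k i j) = 0"
    proof (cases "even k")
      case True
      then have "k = 2 * (k div 2)" by simp
      then have "\<not> k div 2 < p" using k by blast
      then show ?thesis using True out(1) by simp
    next
      case False
      then have "k = 2 * (k div 2) + 1" by simp
      then have "\<not> k div 2 < q" using k by blast
      then show ?thesis using False out(2) by simp
    qed
  next
    fix ks i assume "ks \<notin> (\<lambda>k. [k]) ` {..<n}"
    then have "\<not> k < n" if "ks = [k]" for k using that by auto
    then show "emb (S, A, v, c) (Vc ks i) = 0"
      by (cases "\<exists>k. ks = [k]") (auto simp: out(3) split: list.splits)
  next
    fix ks assume "ks \<notin> (\<lambda>k. [k]) ` {..<m}"
    then have "\<not> k < m" if "ks = [k]" for k using that by auto
    then show "emb (S, A, v, c) (Sc ks) = 0"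
      by (cases "\<exists>k. ks = [k]") (auto simp: out(4) split: list.splits)
  qed
qed

lemma poly_funs_emb:
  "f \<in> poly_funs \<Longrightarrow> \<exists>G\<in>polys UNIV. \<forall>x. f x = G (emb x)"
proof (induction rule: poly_funs.induct)
  case (pconst a)
  show ?case by (rule bexI[of _ "\<lambda>w. a"]) (simp_all add: polys.const)
next
  case (pcoord u)
  have "\<exists>w. \<forall>x. coord_val u x = emb x w"
  proof (cases u)
    case (SymC k i j)
    then show ?thesis by (intro exI[of _ "Mc (2 * k) i j"]) auto
  next
    case (AltC k i j)
    then show ?thesis by (intro exI[of _ "Mc (2 * k + 1) i j"]) auto
  next
    case (VecC k i)
    then show ?thesis by (intro exI[of _ "Vc [k] i"]) auto
  next
    case (ScalC k)
    then show ?thesis by (intro exI[of _ "Sc [k]"]) auto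
  qed
  then obtain w where "\<forall>x. coord_val u x = emb x w" ..
  then show ?case by (rule_tac bexI[of _ "\<lambda>y. y w"]) (simp_all add: polys.coord)
next
  case (padd f g)
  then obtain F G where FG: "F \<in> polys UNIV" "G \<in> polys UNIV" "\<forall>x. f x = F (emb x)" "\<forall>x. g x = G (emb x)"
    by blast
  then show ?case by (rule_tac bexI[of _ "\<lambda>y. F y + G y"]) (simp_all add: polys.add)
next
  case (pmult f g)
  then obtain F G where FG: "F \<in> polys UNIV" "G \<in> polys UNIV" "\<forall>x. f x = F (emb x)" "\<forall>x. g x = G (emb x)"
    by blast
  then show ?case by (rule_tac bexI[of _ "\<lambda>y. F y * G y"]) (simp_all add: polys.mult)
qed

definition transv :: "nat \<Rightarrow> nat \<Rightarrow> complex \<Rightarrow> nat \<Rightarrow> nat \<Rightarrow> complex" where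
  "transv i a t r c = (if r = c then 1 else 0) + (if r = i \<and> c = a then t else 0)"

lemma gvec_transv:
  assumes "i \<noteq> a"
  shows "gvec (transv i a t) w r = w r + (if r = i then t * w a else 0)"
proof -
  \<comment> \<open>The sum over the support of row \<open>r\<close> is extended by zeros to a fixed
    two-element index set.\<close>
  have "gvec (transv i a t) w r = (\<Sum>c\<in>{r, a}. transv i a t r c * w c)"
    unfolding gvec_def by (rule sum.mono_neutral_left) (auto simp: transv_def split: if_splits)
  also have "\<dots> = w r + (if r = i then t * w a else 0)"
    using assms by (cases "r = a") (auto simp: transv_def)
  finally show ?thesis .
qed

text \<open>\<open>g M g^T\<close> arises by applying \<open>g\<close> to each row and then to the
  resulting columns, which reduces matrices to the formula for vectors.\<close>

lemma gmat_gvec: "gmat g M r s = gvec g (\<lambda>a. gvec g (M a) s) r"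
proof -
  have "x * y * z = x * (z * y)" for x y z :: complex by (simp only: mult.assoc mult.commute[of y])
  then show ?thesis unfolding gmat_def gvec_def sum_distrib_left by (intro sum.cong refl)
qed

lemma transv_Ginf:
  assumes "i \<noteq> a" shows "transv i a t \<in> Ginf"
proof -
  define k where "k = Suc (max i a)"
  have k: "i < k" "a < k" by (auto simp: k_def)
  have out: "id_outside k (transv i a s)" for s
    unfolding id_outside_def transv_def using k by auto
  \<comment> \<open>The inverse is the transvection with parameter \<open>- t\<close>.\<close>
  have "(\<Sum>l<k. transv i a t r l * transv i a (- t) l c) = (if r = c then 1 else 0)" if "r < k" for r c
  proof -
    have "(\<Sum>l<k. transv i a t r l * transv i a (- t) l c)
      = (\<Sum>l<k. (if l = r then transv i a (- t) r c else 0)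
          + (if l = a then (if r = i then t * transv i a (- t) a c else 0) else 0))"
      by (rule sum.cong[OF refl]) (auto simp: transv_def[of i a t] distrib_right)
    also have "\<dots> = transv i a (- t) r c + (if r = i then t * transv i a (- t) a c else 0)"
      using that k by (simp add: sum.distrib)
    also have "\<dots> = (if r = c then 1 else 0)"
      using assms by (auto simp: transv_def)
    finally show ?thesis .
  qed
  then show ?thesis unfolding Ginf_def using out by blast
qed

lemma emb_gact:
  assumes "i \<noteq> a" shows "emb (gact (transv i a t) x) = tv i a t (emb x)"
proof
  fix u
  obtain S A v c where x: "x = (S, A, v, c)" by (cases x)
  show "emb (gact (transv i a t) x) u = tv i a t (emb x) u"
  proof (cases u)
    case (Mc k l m)
    show ?thesis
      unfolding x Mc gact_def
      by (cases "l = i"; cases "m = i")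
        (simp_all add: gmat_gvec gvec_transv[OF assms] distrib_left)
  next
    case (Vc ks l)
    then show ?thesis
      unfolding x gact_def by (auto simp: gvec_transv[OF assms] split: list.splits)
  next
    case (Sc ks)
    then show ?thesis unfolding x gact_def by simp
  qed
qed

theorem mainTheorem1:
  fixes p q n m :: nat
  shows "G_noetherian (Tspace p q n m)"
  unfolding G_noetherian_def
proof
  assume "\<exists>Z :: nat \<Rightarrow> pt set. \<forall>i. zariski_closed_in (Tspace p q n m) (Z i) \<and> G_stable (Z i) \<and> Z (Suc i) \<subset> Z i"
  then obtain Z where Z: "\<forall>i. zariski_closed_in (Tspace p q n m) (Z i) \<and> G_stable (Z i) \<and> Z (Suc i) \<subset> Z i" ..
  then have cl: "zariski_closed_in (Tspace p q n m) (Z i)" and st: "G_stable (Z i)"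
    and de: "Z (Suc i) \<subset> Z i" for i
    by simp_all
  have ZT: "Z i \<subseteq> Tspace p q n m" for i using cl[of i] unfolding zariski_closed_in_def by blast
  \<comment> \<open>A chain in the given space becomes constant because its image under
    \<open>emb\<close> lies in a Noetherian ambient space; this contradicts strictness.\<close>
  have "\<exists>k C. \<forall>j\<ge>k. Z j = C"
  proof (rule noeth_transfer[OF noeth_W stable_W, where \<phi> = emb])
    show "Z (Suc k) \<subseteq> Z k" for k using de[of k] by blast
    show "emb z \<in> W ((\<lambda>k. 2 * k) ` {..<p} \<union> (\<lambda>k. 2 * k + 1) ` {..<q})
      ((\<lambda>k. [k]) ` {..<n}) ((\<lambda>k. [k]) ` {..<m})" if "z \<in> Z 0" for z
      using emb_in_W that ZT by blast
    show "tv i a t (emb z) \<in> emb ` Z k" if z: "z \<in> Z k" and ia: "i \<noteq> a" for k z i a t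
    proof -
      have "gact (transv i a t) z \<in> Z k"
        using st[of k] z transv_Ginf[OF ia] unfolding G_stable_def by blast
      then show ?thesis using emb_gact[OF ia, of t z] by (metis imageI)
    qed
    show "\<exists>f\<in>polys UNIV. f (emb z) \<noteq> 0 \<and> (\<forall>z'\<in>Z k. f (emb z') = 0)"
      if z: "z \<in> Z 0" "z \<notin> Z k" for k z
    proof -
      obtain Q where Q: "Q \<subseteq> poly_funs" "Z k = {x \<in> Tspace p q n m. \<forall>f\<in>Q. f x = 0}"
        using cl[of k] unfolding zariski_closed_in_def by blast
      \<comment> \<open>A defining equation of \<open>Z k\<close> that fails at \<open>z\<close>
        does the separating.\<close>
      obtain f where f: "f \<in> Q" "f z \<noteq> 0" using z ZT[of 0] Q(2) by blast
      obtain F where F: "F \<in> polys UNIV" "\<forall>x. f x = F (emb x)"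
        using poly_funs_emb f(1) Q(1) by blast
      have "F (emb z) \<noteq> 0" using F(2)[THEN spec, of z] f(2) by simp
      moreover have "F (emb z') = 0" if "z' \<in> Z k" for z'
      proof -
        have "f z' = 0" using that f(1) unfolding Q(2) by blast
        then show ?thesis using F(2)[THEN spec, of z'] by simp
      qed
      ultimately show ?thesis using F(1) by blast
    qed
  qed simp_all
  then obtain k C where "\<And>j. j \<ge> k \<Longrightarrow> Z j = C" by blast
  then have "Z (Suc k) = Z k" by simp
  then show False using de[of k] by simp
qed

end
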